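(* Let $C\in\mathbb{S}[t]$ be a generic monic quadratic split quaternion polynomial with two complementary factorizations $C=(t-h_1)(t-h_2)=(t-k_1)(t-k_2)$, where $h_1,h_2,k_1,k_2\in\mathbb{S}$. Let $H_1=[h_1-\overline{h_1}]$, $K_1=[k_1-\overline{k_1}]$ be the fixed joints, let $H_2(t),K_2(t)$ be the moving joints at parameter value $t$, and let $S(t)$ be the intersection point of the line spanned by $H_1,H_2(t)$ and the line spanned by $K_1,K_2(t)$ (extended by continuity to parameter values where this intersection is not well defined). Then the locus of all points $S(t)$, for varying $t\in\mathbb{R}\cup\{\infty\}$, is a conic $\mathcal{S}$ having $H_1$ and $K_1$ as focal points. Moreover, if $\varrho(t)$ denotes the reflection in the tangent of $\mathcal{S}$ at $S(t)$ (for those $t$ for which this tangent is non-null, so that the reflection is defined), then $\varrho(t)$ maps $H_1$ to $K_2(t)$ and $K_1$ to $H_2(t)$.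
   Context: Split quaternions: $\mathbb{S}$ is the real associative algebra with basis $1,\mathbf{i},\mathbf{j},\mathbf{k}$ and relations $\mathbf{i}^2=-1$, $\mathbf{j}^2=\mathbf{k}^2=1$, $\mathbf{i}\mathbf{j}\mathbf{k}=1$. The conjugate of $h=h_0+h_1\mathbf{i}+h_2\mathbf{j}+h_3\mathbf{k}$ is $\overline{h}=h_0-h_1\mathbf{i}-h_2\mathbf{j}-h_3\mathbf{k}$, and $h\overline{h}=h_0^2+h_1^2-h_2^2-h_3^2\in\mathbb{R}$. $\mathbb{S}[t]$ is the ring of polynomials over $\mathbb{S}$ in which $t$ commutes with all coefficients. For $C=\sum c_\ell t^\ell$, $\overline{C}=\sum\overline{c_\ell}t^\ell$; then $C\overline{C}\in\mathbb{R}[t]$. Complementary: two factorizations $C=(t-h_1)(t-h_2)=(t-k_1)(t-k_2)$ are complementary if $C\overline{C}=MN$ with $M=(t-h_1)(t-\overline{h_1})$ and $N=(t-k_1)(t-\overline{k_1})$; here $M$ and $N$ are relatively prime. Generic: a monic quadratic $C=t^2+c_1t+c_0\in\mathbb{S}[t]$ is generic if (i) $1,c_1,c_0$ are linearly independent over $\mathbb{R}$, and (ii) for every real monic quadratic factor $M$ of $C\overline{C}$ the linear polynomial $C-M=r_1t+r_0$ has a unique zero, i.e. there is exactly one $h\in\mathbb{S}$ with $r_1h+r_0=0$. It is also part of the genericity assumption that the points $[h_i-\overline{h_i}]$, $[k_i-\overline{k_i}]$ ($i=1,2$) are non-null. Geometry: $V$ is the 3-dimensional real vector space of split quaternions with zero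 real part, with $\langle a,b\rangle=\tfrac12(a\overline{b}+b\overline{a})$ and $a\times b=\tfrac12(ab-ba)$. $P^2$ is the projective plane over $V$, $[a]$ is the point represented by $a\in V\setminus\{0\}$. The line $[u]$, $u\in V\setminus\{0\}$, consists of the points $[x]$ with $\langle u,x\rangle=0$; the line spanned by $[a]$ and $[b]$ is $[a\times b]$, and dually the intersection point of lines $[u],[v]$ is $[u\times v]$. The null circle is the conic $\mathcal{N}=\{[x]:\langle x,x\rangle=0\}$; its points are the null points and its tangents (the lines $[u]$ with $\langle u,u\rangle=0$) are the null lines. The reflection in a non-null line $[u]$ is the unique (non-identical) homology fixing that line pointwise and preserving $\mathcal{N}$, i.e. $[x]\mapsto\left[x-2\frac{\langle u,x\rangle}{\langle u,u\rangle}u\right]$. Focal points: a null tangent of a conic is a tangent of the conic that is a null line (possibly in the complex extension of $P^2$). The focal points of a conic are the real intersection points of its null tangents (intersections of two distinct null tangents). Moving joints: $H_2(t)=[(t-h_1)(h_2-\overline{h_2})(t-\overline{h_1})]$ and $K_2(t)=[(t-k_1)(k_2-\overline{k_2})(t-\overline{k_1})]$, with $H_2(\infty)=[h_2-\overline{h_2}]$, $K_2(\infty)=[k_2-\overline{k_2}]$. Thus $S(t)$ is the point represented by the polynomial vector $(\eta_1\times\eta_2(t))\times(\kappa_1\times\kappa_2(t))$, where $\eta_1=h_1-\overline{h_1}$, $\kappa_1=k_1-\overline{k_1}$, $\eta_2(t)=(t-h_1)(h_2-\overline{h_2})(t-\overline{h_1})$, $\kappa_2(t)=(t-k_1)(k_2-\overline{k_2})(t-\overline{k_1})$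 are representatives of $H_1,K_1,H_2(t),K_2(t)$, respectively, after dividing out common real polynomial factors of its coordinates (this is the extension by continuity). *)

theory Defs
  imports
    "HOL-Analysis.Analysis"
    "HOL-Computational_Algebra.Computational_Algebra"
    "HOL-Library.Poly_Mapping"
begin

text \<open>
  Split quaternions over a commutative ring of scalars. The split quaternions of the text are
  \<open>real sq\<close>; \<open>complex sq\<close> is their complexification and only serves to speak about
  the complex extension of the projective plane.
\<close>

datatype 'a sq = Sq (sq0: 'a) (sq1: 'a) (sq2: 'a) (sq3: 'a)

instantiation sq :: (comm_ring_1) ring_1
begin

definition "0 = Sq 0 0 0 0"
definition "1 = Sq 1 0 0 0"
definition "a + b = Sq (sq0 a + sq0 b) (sq1 a + sq1 b) (sq2 a + sq2 b) (sq3 a + sq3 b)"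
definition "a - b = Sq (sq0 a - sq0 b) (sq1 a - sq1 b) (sq2 a - sq2 b) (sq3 a - sq3 b)"
definition "- a = Sq (- sq0 a) (- sq1 a) (- sq2 a) (- sq3 a)"
definition "a * b = Sq
  (sq0 a * sq0 b - sq1 a * sq1 b + sq2 a * sq2 b + sq3 a * sq3 b)
  (sq0 a * sq1 b + sq1 a * sq0 b - sq2 a * sq3 b + sq3 a * sq2 b)
  (sq0 a * sq2 b + sq2 a * sq0 b + sq3 a * sq1 b - sq1 a * sq3 b)
  (sq0 a * sq3 b + sq3 a * sq0 b + sq1 a * sq2 b - sq2 a * sq1 b)"

instance
  by standard
    (auto simp: zero_sq_def one_sq_def plus_sq_def minus_sq_def uminus_sq_def times_sq_def
      algebra_simps intro: sq.expand)

end

lemma sq_relations: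
  fixes qi qj qk :: "'a::comm_ring_1 sq"
  defines "qi \<equiv> Sq 0 1 0 0" and "qj \<equiv> Sq 0 0 1 0" and "qk \<equiv> Sq 0 0 0 1"
  shows "qi * qi = - 1" "qj * qj = 1" "qk * qk = 1" "qi * qj * qk = 1"
  by (simp_all add: assms one_sq_def times_sq_def uminus_sq_def)

definition sc :: "'a::comm_ring_1 \<Rightarrow> 'a sq"
  where "sc c = Sq c 0 0 0"

definition sq_cnj :: "'a::comm_ring_1 sq \<Rightarrow> 'a sq"
  where "sq_cnj h = Sq (sq0 h) (- sq1 h) (- sq2 h) (- sq3 h)"

lemma sq_mult_cnj:
  "h * sq_cnj h = sc ((sq0 h)\<^sup>2 + (sq1 h)\<^sup>2 - (sq2 h)\<^sup>2 - (sq3 h)\<^sup>2)"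
  by (simp add: sc_def sq_cnj_def times_sq_def power2_eq_square algebra_simps)

text \<open>
  Polynomials over the split quaternions. The type \<open>'a poly\<close> has a product only for
  commutative coefficients, hence we use the monoid ring \<open>nat \<Rightarrow>\<^sub>0 real sq\<close>, in which the
  indeterminate \<open>sqT\<close> commutes with all coefficients.
\<close>

type_synonym sq_poly = "nat \<Rightarrow>\<^sub>0 real sq"

definition sqT :: sq_poly
  where "sqT = Poly_Mapping.single 1 1"

definition sqC :: "real sq \<Rightarrow> sq_poly"
  where "sqC h = Poly_Mapping.single 0 h"

definition poly_cnj :: "sq_poly \<Rightarrow> sq_poly"
  where "poly_cnj P = Poly_Mapping.map sq_cnj P"

definition real_sq_poly :: "real poly \<Rightarrow> sq_poly"
  where "real_sq_poly p = (\<Sum>n\<le>degree p. Poly_Mapping.single n (sc (coeff p n)))"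

definition generic :: "sq_poly \<Rightarrow> bool" where
  "generic C \<longleftrightarrow>
    (\<exists>c1 c0. C = sqT ^ 2 + sqC c1 * sqT + sqC c0 \<and>
      (\<forall>a b c :: real. sc a + sc b * c1 + sc c * c0 = 0 \<longrightarrow> a = 0 \<and> b = 0 \<and> c = 0)) \<and>
    (\<forall>M :: real poly. degree M = 2 \<and> lead_coeff M = 1 \<and>
        (\<exists>N. C * poly_cnj C = real_sq_poly (M * N)) \<longrightarrow>
      (\<exists>r1 r0. C - real_sq_poly M = sqC r1 * sqT + sqC r0 \<and> (\<exists>!h. r1 * h + r0 = 0)))"

definition complementary ::
  "sq_poly \<Rightarrow> real sq \<Rightarrow> real sq \<Rightarrow> real sq \<Rightarrow> real sq \<Rightarrow> bool" where
  "complementary C h1 h2 k1 k2 \<longleftrightarrow>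
    C = (sqT - sqC h1) * (sqT - sqC h2) \<and>
    C = (sqT - sqC k1) * (sqT - sqC k2) \<and>
    (\<exists>M N :: real poly.
      real_sq_poly M = (sqT - sqC h1) * (sqT - sqC (sq_cnj h1)) \<and>
      real_sq_poly N = (sqT - sqC k1) * (sqT - sqC (sq_cnj k1)) \<and>
      C * poly_cnj C = real_sq_poly M * real_sq_poly N \<and>
      coprime M N)"

text \<open>
  The projective plane over the space \<open>sqV\<close> of split quaternions with zero real part. A point
  is identified with the one-dimensional space of its representatives (including \<open>0\<close>).
  A line is identified with the set of its points.
\<close>

definition sqV :: "'a::comm_ring_1 sq set"
  where "sqV = {x. sq0 x = 0}"

definition sq_inner :: "'a::field sq \<Rightarrow> 'a sq \<Rightarrow> 'a"
  where "sq_inner a b = sq0 (sc (1/2) * (a * sq_cnj b + b * sq_cnj a))"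

lemma sc_sq_inner:
  fixes a b :: "'a::field sq"
  shows "sc (sq_inner a b) = sc (1/2) * (a * sq_cnj b + b * sq_cnj a)"
  by (simp add: sq_inner_def sc_def sq_cnj_def times_sq_def plus_sq_def algebra_simps)

definition pt :: "'a::comm_ring_1 sq \<Rightarrow> 'a sq set"
  where "pt x = range (\<lambda>c. sc c * x)"

definition points :: "'a::comm_ring_1 sq set set"
  where "points = pt ` (sqV - {0})"

definition line :: "'a::field sq \<Rightarrow> 'a sq set set"
  where "line u = {X \<in> points. \<forall>x\<in>X. sq_inner u x = 0}"

text \<open>The reflection in the line \<open>line u\<close>, as a map on points; meant for non-null \<open>u\<close>.\<close>

definition reflection :: "real sq \<Rightarrow> real sq set \<Rightarrow> real sq set" where
  "reflection u X = (\<lambda>x. x - sc (2 * (sq_inner u x / sq_inner u u)) * u) ` X"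

text \<open>
  Conics are given by invertible symmetric real matrices with respect to the basis
  \<open>Sq 0 1 0 0, Sq 0 0 1 0, Sq 0 0 0 1\<close> of \<open>sqV\<close>; \<open>bil A\<close> is the corresponding bilinear form on the real space or
  on its complexification.
\<close>

definition coords :: "'a::zero sq \<Rightarrow> 'a ^ 3"
  where "coords x = vector [sq1 x, sq2 x, sq3 x]"

definition bil :: "real^3^3 \<Rightarrow> 'a::real_field sq \<Rightarrow> 'a sq \<Rightarrow> 'a" where
  "bil A x y = (\<Sum>i\<in>UNIV. \<Sum>j\<in>UNIV. of_real (A $ i $ j) * coords x $ i * coords y $ j)"

definition regular_form :: "real^3^3 \<Rightarrow> bool"
  where "regular_form A \<longleftrightarrow> transpose A = A \<and> det A \<noteq> 0"

definition conic_of :: "real^3^3 \<Rightarrow> 'a::real_field sq set set"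
  where "conic_of A = {X \<in> points. \<forall>x\<in>X. bil A x x = 0}"

definition tangent :: "real^3^3 \<Rightarrow> 'a::real_field sq set \<Rightarrow> 'a sq set set"
  where "tangent A X = {Y \<in> points. \<forall>x\<in>X. \<forall>y\<in>Y. bil A x y = 0}"

definition null_tangents :: "real^3^3 \<Rightarrow> complex sq set set set" where
  "null_tangents A =
    {L. (\<exists>X\<in>conic_of A. L = tangent A X) \<and> (\<exists>u\<in>sqV - {0}. L = line u \<and> sq_inner u u = 0)}"

definition complexify :: "real sq \<Rightarrow> complex sq"
  where "complexify x = map_sq complex_of_real x"

definition focal_points :: "real^3^3 \<Rightarrow> real sq set set" where
  "focal_points A =
    {pt x | x. x \<in> sqV - {0} \<and>
      (\<exists>L\<in>null_tangents A. \<exists>L'\<in>null_tangents A. L \<noteq> L' \<and> pt (complexify x) \<in> L \<inter> L')}"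

text \<open>
  Points parametrised by polynomial vectors. At infinity, the value of a polynomial vector is its
  leading coefficient, which represents the limit of the points represented by its values.
\<close>

datatype param = Fin real | Infinity

fun sq_poly_at :: "sq_poly \<Rightarrow> param \<Rightarrow> real sq" where
  "sq_poly_at P (Fin t) = (\<Sum>n\<in>Poly_Mapping.keys P. sc (t ^ n) * Poly_Mapping.lookup P n)"
| "sq_poly_at P Infinity = Poly_Mapping.lookup P (Max (Poly_Mapping.keys P))"

definition poly_cross :: "sq_poly \<Rightarrow> sq_poly \<Rightarrow> sq_poly"
  where "poly_cross P Q = sqC (sc (1/2)) * (P * Q - Q * P)"

text \<open>
  A real polynomial \<open>g\<close> divides all coordinates of \<open>P\<close> iff \<open>P = real_sq_poly g * R\<close> for
  some \<open>R\<close>. For \<open>P \<noteq> 0\<close> the polynomial chosen below exists and is unique up to a non-zero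
  real factor.
\<close>

definition reduced :: "sq_poly \<Rightarrow> sq_poly" where
  "reduced P = (SOME Q. (\<exists>g. P = real_sq_poly g * Q) \<and>
    (\<forall>g R. Q = real_sq_poly g * R \<longrightarrow> degree g = 0))"

definition fixed_axis :: "real sq \<Rightarrow> real sq"
  where "fixed_axis h = h - sq_cnj h"

definition moving_axis :: "real sq \<Rightarrow> real sq \<Rightarrow> sq_poly" where
  "moving_axis h g = (sqT - sqC h) * sqC (g - sq_cnj g) * (sqT - sqC (sq_cnj h))"

lemma moving_axis_expand:
  "moving_axis h g = Poly_Mapping.single 2 (g - sq_cnj g)
    + Poly_Mapping.single 1 (- (h * (g - sq_cnj g)) - (g - sq_cnj g) * sq_cnj h)
    + Poly_Mapping.single 0 (h * (g - sq_cnj g) * sq_cnj h)"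
  by (simp add: moving_axis_def sqT_def sqC_def algebra_simps mult_single
      flip: single_add single_diff single_uminus numeral_2_eq_2)

lemma lookup_moving_axis:
  "Poly_Mapping.lookup (moving_axis h g) n =
    (if n = 2 then g - sq_cnj g
     else if n = 1 then - (h * (g - sq_cnj g)) - (g - sq_cnj g) * sq_cnj h
     else if n = 0 then h * (g - sq_cnj g) * sq_cnj h else 0)"
  by (auto simp: moving_axis_expand lookup_add lookup_single when_def)

lemma keys_moving_axis: "Poly_Mapping.keys (moving_axis h g) \<subseteq> {0, 1, 2}"
  by (auto simp: in_keys_iff lookup_moving_axis split: if_splits)

lemma moving_axis_at_Infinity:
  assumes "g \<noteq> sq_cnj g"
  shows "sq_poly_at (moving_axis h g) Infinity = g - sq_cnj g"
proof -
  have "2 \<in> Poly_Mapping.keys (moving_axis h g)"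
    using assms by (simp add: in_keys_iff lookup_moving_axis)
  then have "Max (Poly_Mapping.keys (moving_axis h g)) = 2"
    using keys_moving_axis[of h g] by (intro Max_eqI) auto
  then show ?thesis
    by (simp add: lookup_moving_axis)
qed

lemma moving_axis_at_Fin:
  "sq_poly_at (moving_axis h g) (Fin t) = (sc t - h) * (g - sq_cnj g) * (sc t - sq_cnj h)"
proof -
  have "sq_poly_at (moving_axis h g) (Fin t) =
      (\<Sum>n\<in>{0, 1, 2}. sc (t ^ n) * Poly_Mapping.lookup (moving_axis h g) n)"
    unfolding sq_poly_at.simps using keys_moving_axis[of h g]
    by (intro sum.mono_neutral_left) (auto simp: in_keys_iff)
  then show ?thesis
    by (simp add: lookup_moving_axis sc_def zero_sq_def one_sq_def sq_cnj_def times_sq_def plus_sq_def minus_sq_def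
        uminus_sq_def power2_eq_square algebra_simps)
qed

definition fixed_joint :: "real sq \<Rightarrow> real sq set"
  where "fixed_joint h = pt (fixed_axis h)"

definition moving_joint :: "real sq \<Rightarrow> real sq \<Rightarrow> param \<Rightarrow> real sq set"
  where "moving_joint h g t = pt (sq_poly_at (moving_axis h g) t)"

definition meet_poly :: "real sq \<Rightarrow> real sq \<Rightarrow> real sq \<Rightarrow> real sq \<Rightarrow> sq_poly" where
  "meet_poly h1 h2 k1 k2 =
    poly_cross (poly_cross (sqC (fixed_axis h1)) (moving_axis h1 h2))
               (poly_cross (sqC (fixed_axis k1)) (moving_axis k1 k2))"

definition meet_point ::
  "real sq \<Rightarrow> real sq \<Rightarrow> real sq \<Rightarrow> real sq \<Rightarrow> param \<Rightarrow> real sq set" where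
  "meet_point h1 h2 k1 k2 t = pt (sq_poly_at (reduced (meet_poly h1 h2 k1 k2)) t)"

end

(*
  Write A = t - h1, B = t - h2, A' = t - k1, B' = t - k2, so that C = A B = A' B' with
  M = A cnj(A) = B' cnj(B') and N = B cnj(B) = A' cnj(A'), and let e = k2 - h1 = h2 - k1, which is
  pure. Since eta2 = A cnj(C) - C cnj(A) and M kappa1 = B' cnj(C) - C cnj(B'), the vector polynomial
  w = e cnj(C) + C e satisfies
    eta2 = w + M kappa1   and   kappa2 = w + N eta1.
  Hence the reflection in the line w(t) maps eta1 to kappa2 / N and kappa1 to eta2 / M, and
  S = w + N eta1 + M kappa1 lies on both lines that define the intersection point. Up to constant
  multiples of <w2, w2>, where w2 = 2 e is the leading coefficient of w, <w, eta1> equals M,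
  <w, kappa1> equals N and <w, w> equals M N. This forces <w(t), S(s)> = D (t - s)^2, so w(t)
  envelops a conic that it touches at S(t), and the (complex) null tangents through eta1 and kappa1
  belong to the roots of M and N. The constant D is nonzero by genericity.
*)
theory Submission
  imports Defs
begin

section \<open>Split quaternion arithmetic\<close>

lemmas sq_defs = zero_sq_def one_sq_def plus_sq_def minus_sq_def uminus_sq_def times_sq_def
  sc_def sq_cnj_def

lemma sq_sel [simp]:
  "sq0 (a + b) = sq0 a + sq0 b" "sq1 (a + b) = sq1 a + sq1 b"
  "sq2 (a + b) = sq2 a + sq2 b" "sq3 (a + b) = sq3 a + sq3 b"
  "sq0 (a - b) = sq0 a - sq0 b" "sq1 (a - b) = sq1 a - sq1 b"
  "sq2 (a - b) = sq2 a - sq2 b" "sq3 (a - b) = sq3 a - sq3 b"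
  "sq0 (- a) = - sq0 a" "sq1 (- a) = - sq1 a" "sq2 (- a) = - sq2 a" "sq3 (- a) = - sq3 a"
  "sq0 (0 :: 'a sq) = 0" "sq1 (0 :: 'a sq) = 0" "sq2 (0 :: 'a sq) = 0" "sq3 (0 :: 'a sq) = 0"
  "sq0 (sc c * a) = c * sq0 a" "sq1 (sc c * a) = c * sq1 a"
  "sq2 (sc c * a) = c * sq2 a" "sq3 (sc c * a) = c * sq3 a"
  "sq0 (sc c) = c" "sq1 (sc c) = 0" "sq2 (sc c) = 0" "sq3 (sc c) = 0"
  "sq0 (sq_cnj a) = sq0 a" "sq1 (sq_cnj a) = - sq1 a"
  "sq2 (sq_cnj a) = - sq2 a" "sq3 (sq_cnj a) = - sq3 a"
  for a b :: "'a::comm_ring_1 sq"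
  by (simp_all add: sq_defs)

lemma sc_add: "sc (a + b) = sc a + sc b"
  and sc_minus: "sc (- a) = - sc a"
  and sc_mult: "sc (a * b) = sc a * sc b"
  and sc_commute: "x * sc a = sc a * x"
  and sc_0 [simp]: "sc 0 = 0" and sc_1 [simp]: "sc 1 = 1"
  for a b :: "'a::comm_ring_1"
  by (auto simp: sq_defs algebra_simps intro: sq.expand)

lemma sc_eq_iff: "sc a = sc b \<longleftrightarrow> a = b" for a b :: "'a::comm_ring_1"
  by (simp add: sq_defs)

lemma sc_left_commute: "x * (sc a * y) = sc a * (x * y)" for a :: "'a::comm_ring_1"
  by (metis mult.assoc sc_commute)

lemma sc_mult_eq_0_iff [simp]: "sc c * x = 0 \<longleftrightarrow> c = 0 \<or> x = 0"
  for x :: "'a::idom sq"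
  by (auto simp: sq_defs intro: sq.expand)

lemma sq_cnj_add: "sq_cnj (x + y) = sq_cnj x + sq_cnj y"
  and sq_cnj_diff: "sq_cnj (x - y) = sq_cnj x - sq_cnj y"
  and sq_cnj_mult: "sq_cnj (x * y) = sq_cnj y * sq_cnj x"
  and sq_cnj_0 [simp]: "sq_cnj (0 :: 'a sq) = 0"
  and sq_cnj_sc [simp]: "sq_cnj (sc c) = sc c"
  and sq_cnj_cnj [simp]: "sq_cnj (sq_cnj x) = x"
  for x y :: "'a::comm_ring_1 sq"
  by (auto simp: sq_defs algebra_simps intro: sq.expand)

lemma sq_inner_eq:
  "sq_inner a b = sq0 a * sq0 b + sq1 a * sq1 b - sq2 a * sq2 b - sq3 a * sq3 b"
  for a b :: "'a::real_field sq"
  by (simp add: sq_inner_def sq_defs field_simps)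

lemma sq_inner_add_left: "sq_inner (a + b) c = sq_inner a c + sq_inner b c"
  and sq_inner_add_right: "sq_inner c (a + b) = sq_inner c a + sq_inner c b"
  and sq_inner_diff_left: "sq_inner (a - b) c = sq_inner a c - sq_inner b c"
  and sq_inner_diff_right: "sq_inner c (a - b) = sq_inner c a - sq_inner c b"
  and sq_inner_scale_left: "sq_inner (sc r * a) c = r * sq_inner a c"
  and sq_inner_scale_right: "sq_inner c (sc r * a) = r * sq_inner c a"
  and sq_inner_zero_left [simp]: "sq_inner 0 c = 0"
  and sq_inner_zero_right [simp]: "sq_inner c 0 = 0"
  for a b c :: "'a::real_field sq"
  by (simp_all add: sq_inner_eq algebra_simps)

lemmas sq_inner_linear = sq_inner_add_left sq_inner_add_right sq_inner_diff_left
  sq_inner_diff_right sq_inner_scale_left sq_inner_scale_right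

lemma sq_inner_commute: "sq_inner a b = sq_inner b a" for a b :: "'a::real_field sq"
  by (simp add: sq_inner_eq algebra_simps)

lemma mult_sq_cnj: "a * sq_cnj a = sc (sq_inner a a)"
 for a :: "'a::real_field sq"
  by (auto simp: sq_inner_eq sq_defs algebra_simps intro: sq.expand)

lemma sq_inner_mult_self: "sq_inner (a * b) (a * b) = sq_inner a a * sq_inner b b"
  for a b :: "'a::real_field sq"
  by (simp add: sq_inner_eq sq_defs algebra_simps)

lemma sq_inner_cnj_self: "sq_inner (sq_cnj a) (sq_cnj a) = sq_inner a a"
  for a :: "'a::real_field sq"
  by (simp add: sq_inner_eq)

section \<open>Evaluation of split quaternion polynomials at real parameters\<close>

definition ev :: "real \<Rightarrow> sq_poly \<Rightarrow> real sq"
  where "ev t P = sq_poly_at P (Fin t)"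

lemma ev_superset:
  assumes "finite F" "Poly_Mapping.keys P \<subseteq> F"
  shows "ev t P = (\<Sum>n\<in>F. sc (t ^ n) * Poly_Mapping.lookup P n)"
  unfolding ev_def sq_poly_at.simps using assms
  by (intro sum.mono_neutral_left) (auto simp: in_keys_iff)

lemma ev_zero [simp]: "ev t 0 = 0"
  by (simp add: ev_def)

lemma ev_add: "ev t (P + Q) = ev t P + ev t Q"
proof -
  let ?F = "Poly_Mapping.keys P \<union> Poly_Mapping.keys Q"
  have "ev t (P + Q) = (\<Sum>n\<in>?F. sc (t ^ n) * Poly_Mapping.lookup (P + Q) n)"
    by (rule ev_superset) (auto simp: keys_add)
  also have "\<dots> = (\<Sum>n\<in>?F. sc (t ^ n) * Poly_Mapping.lookup P n) +
      (\<Sum>n\<in>?F. sc (t ^ n) * Poly_Mapping.lookup Q n)"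
    by (simp add: lookup_add distrib_left sum.distrib)
  also have "\<dots> = ev t P + ev t Q"
    by (simp add: ev_superset[of ?F])
  finally show ?thesis .
qed

lemma ev_single: "ev t (Poly_Mapping.single n c) = sc (t ^ n) * c"
  by (subst ev_superset[of "{n}"]) auto

lemma ev_diff: "ev t (P - Q) = ev t P - ev t Q"
  using ev_add[of t "P - Q" Q] by simp

lemma ev_sum: "ev t (\<Sum>i\<in>I. f i) = (\<Sum>i\<in>I. ev t (f i))"
  by (induction I rule: infinite_finite_induct) (simp_all add: ev_add)

lemma sum_single_lookup:
  "P = (\<Sum>n\<in>Poly_Mapping.keys P. Poly_Mapping.single n (Poly_Mapping.lookup P n))"
  by (rule poly_mapping_eqI)
    (auto simp: lookup_sum lookup_single when_def in_keys_iff sum.delta)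

text \<open>Real scalars are central, so powers of \<open>t\<close> pass the coefficients of
  \<open>P\<close>. Identities in the monoid ring can therefore be checked at all real
  \<open>t\<close>.\<close>

lemma ev_mult: "ev t (P * Q) = ev t P * ev t Q"
proof -
  let ?p = "Poly_Mapping.lookup P" and ?q = "Poly_Mapping.lookup Q"
    and ?K = "Poly_Mapping.keys P" and ?L = "Poly_Mapping.keys Q"
  have "P * Q = (\<Sum>n\<in>?K. Poly_Mapping.single n (?p n)) * (\<Sum>m\<in>?L. Poly_Mapping.single m (?q m))"
    by (subst (1) sum_single_lookup, subst (2) sum_single_lookup) (rule refl)
  also have "\<dots> = (\<Sum>n\<in>?K. \<Sum>m\<in>?L. Poly_Mapping.single (n + m) (?p n * ?q m))"
    by (simp add: sum_product mult_single)
  finally have "ev t (P * Q) = (\<Sum>n\<in>?K. \<Sum>m\<in>?L. sc (t ^ (n + m)) * (?p n * ?q m))"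
    by (simp add: ev_sum ev_single)
  also have "\<dots> = (\<Sum>n\<in>?K. \<Sum>m\<in>?L. sc (t ^ n) * ?p n * (sc (t ^ m) * ?q m))"
    by (simp add: power_add sc_mult sc_left_commute[of "?p n" for n] mult.assoc)
  also have "\<dots> = ev t P * ev t Q"
    by (simp add: ev_def sum_product)
  finally show ?thesis .
qed

lemma ev_sqC [simp]: "ev t (sqC c) = c" and ev_sqT [simp]: "ev t sqT = sc t"
  by (simp_all add: sqC_def sqT_def ev_single)

lemma ev_real_sq_poly [simp]: "ev t (real_sq_poly p) = sc (poly p t)"
proof -
  have "sc (\<Sum>n\<in>I. f n) = (\<Sum>n\<in>I. sc (f n))" for I and f :: "nat \<Rightarrow> real"
    by (induction I rule: infinite_finite_induct) (simp_all add: sc_add)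
  then show ?thesis
    by (simp add: real_sq_poly_def ev_sum ev_single poly_altdef mult.commute flip: sc_mult)
qed

lemma ev_poly_cnj [simp]: "ev t (poly_cnj P) = sq_cnj (ev t P)"
proof -
  have look: "Poly_Mapping.lookup (poly_cnj P) n = sq_cnj (Poly_Mapping.lookup P n)" for n
    by (simp add: poly_cnj_def map.rep_eq when_def sq_defs)
  have cnj_sum: "sq_cnj (\<Sum>n\<in>I. f n) = (\<Sum>n\<in>I. sq_cnj (f n))" for I and f :: "nat \<Rightarrow> real sq"
    by (induction I rule: infinite_finite_induct) (simp_all add: sq_cnj_add)
  have "Poly_Mapping.keys (poly_cnj P) \<subseteq> Poly_Mapping.keys P"
    by (auto simp: in_keys_iff look sq_defs)
  then have "ev t (poly_cnj P) = (\<Sum>n\<in>Poly_Mapping.keys P. sc (t ^ n) * sq_cnj (Poly_Mapping.lookup P n))"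
    by (simp add: ev_superset[OF finite_keys] look)
  also have "\<dots> = sq_cnj (ev t P)"
    by (simp add: ev_def cnj_sum sq_cnj_mult sc_commute)
  finally show ?thesis .
qed

section \<open>Coordinate polynomials and real polynomial factors\<close>

lemma poly_of_coordinate:
  assumes add: "\<And>x y. f (x + y) = f x + f y" and scale: "\<And>c x. f (sc c * x) = c * f x"
  obtains r :: "real poly"
  where "\<And>t. poly r t = f (ev t P)" "\<And>n. coeff r n = f (Poly_Mapping.lookup P n)"
proof -
  let ?r = "\<Sum>n\<in>Poly_Mapping.keys P. monom (f (Poly_Mapping.lookup P n)) n"
  have f0: "f 0 = 0"
    using scale[of 0 0] by simp
  have f_sum: "f (\<Sum>n\<in>I. g n) = (\<Sum>n\<in>I. f (g n))" for I and g :: "nat \<Rightarrow> real sq"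
    by (induction I rule: infinite_finite_induct) (simp_all add: add f0)
  show ?thesis
  proof
    show "poly ?r t = f (ev t P)" for t
      by (simp add: poly_sum poly_monom ev_def f_sum scale mult.commute)
    show "coeff ?r n = f (Poly_Mapping.lookup P n)" for n
      by (auto simp: coeff_sum in_keys_iff f0 sum.delta)
  qed
qed

text \<open>Each coordinate of \<open>P - Q\<close> is a real polynomial whose product with
  \<open>g\<close> vanishes everywhere, and \<open>real poly\<close> is an integral domain. The
  factor \<open>g\<close> cancels even at its own roots.\<close>

lemma sq_poly_eqI_mult:
  assumes g: "g \<noteq> 0" and eq: "\<And>t. sc (poly g t) * ev t P = sc (poly g t) * ev t Q"
  shows "P = Q"
proof -
  have coord: "f (Poly_Mapping.lookup (P - Q) n) = 0"
    if add: "\<And>x y. f (x + y) = f x + f y" and scale: "\<And>c x. f (sc c * x) = c * f x"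
    for f n
  proof -
    obtain r where r: "\<And>t. poly r t = f (ev t (P - Q))"
      "\<And>n. coeff r n = f (Poly_Mapping.lookup (P - Q) n)"
      using poly_of_coordinate[of f "P - Q", OF add scale] by blast
    have zero: "sc (poly g t) * ev t (P - Q) = 0" for t
      by (simp only: ev_diff right_diff_distrib eq diff_self)
    have "poly (g * r) t = 0" for t
      using zero[of t] scale[of 0 0] by (auto simp: r)
    then have "g * r = 0"
      using poly_all_0_iff_0 by blast
    with g have "r = 0"
      by simp
    with r(2) show ?thesis by (metis coeff_0)
  qed
  have "Poly_Mapping.lookup (P - Q) n = 0" for n
    using coord[of sq0 n] coord[of sq1 n] coord[of sq2 n] coord[of sq3 n]
    by (intro sq.expand) simp
  then have "P - Q = 0"
    by (intro poly_mapping_eqI) simp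
  then show ?thesis by simp
qed

lemma sq_poly_eqI: "(\<And>t. ev t P = ev t Q) \<Longrightarrow> P = Q"
  using sq_poly_eqI_mult[of 1 P Q] by simp

text \<open>A real factor of \<open>T\<close> divides its pairing with \<open>w\<close>, the nonzero
  constant \<open>D\<close>, so \<open>T\<close> is primitive. Pairing both representations of
  \<open>P\<close> with \<open>w\<close> shows that the factor belonging to \<open>reduced P\<close>
  divides \<open>g\<close>; by primitivity the quotient is constant.\<close>

lemma reduced_eqI:
  assumes P: "P = real_sq_poly g * T" and "g \<noteq> 0" and "D \<noteq> 0"
    and T: "\<And>t. sq_inner w (ev t T) = D"
  obtains c where "c \<noteq> 0" "reduced P = sqC (sc c) * T"
proof -
  define primitive where "primitive Q \<longleftrightarrow> (\<forall>g R. Q = real_sq_poly g * R \<longrightarrow> degree g = 0)" for Q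
  have inner_poly: "\<exists>r. \<forall>t. poly r t = sq_inner w (ev t R)" for R
    by (rule poly_of_coordinate[of "sq_inner w" R]) (auto simp: sq_inner_linear)
  have "primitive T"
    unfolding primitive_def
  proof (intro allI impI)
    fix f R assume R: "T = real_sq_poly f * R"
    obtain r where r: "\<And>t. poly r t = sq_inner w (ev t R)"
      using inner_poly[of R] by blast
    have "poly (f * r) t = poly [:D:] t" for t
      using T[of t] by (simp add: R ev_mult sq_inner_linear r)
    then have fr: "f * r = [:D:]"
      by (simp add: poly_eq_poly_eq_iff[symmetric] fun_eq_iff)
    then have "f \<noteq> 0" "r \<noteq> 0"
      using assms(3) by auto
    with fr show "degree f = 0"
      by (metis add_is_0 degree_mult_eq degree_pCons_0)
  qed
  with P have "\<exists>Q. (\<exists>g. P = real_sq_poly g * Q) \<and> primitive Q"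
    by blast
  then have "(\<exists>g. P = real_sq_poly g * reduced P) \<and> primitive (reduced P)"
    unfolding reduced_def primitive_def by (rule someI_ex)
  then obtain f where f: "P = real_sq_poly f * reduced P" and prim: "primitive (reduced P)"
    by blast
  obtain r where r: "\<And>t. poly r t = sq_inner w (ev t (reduced P))"
    using inner_poly by blast
  have eq: "sc (poly f t) * ev t (reduced P) = sc (poly g t) * ev t T" for t
    using arg_cong[OF f, of "ev t"] by (simp add: P ev_mult)
  have "poly (f * r) t = poly (smult D g) t" for t
    using arg_cong[OF eq[of t], of "sq_inner w"] by (simp add: sq_inner_linear r T)
  then have "f * r = smult D g"
    by (simp add: poly_eq_poly_eq_iff[symmetric] fun_eq_iff)
  then have g: "g = f * smult (1 / D) r"
    using assms(3) by simp
  then have nz: "f \<noteq> 0" "smult (1 / D) r \<noteq> 0"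
    using assms(2) by auto
  have "reduced P = real_sq_poly (smult (1 / D) r) * T"
  proof (rule sq_poly_eqI_mult[OF nz(1)])
    show "sc (poly f t) * ev t (reduced P) =
        sc (poly f t) * ev t (real_sq_poly (smult (1 / D) r) * T)" for t
      by (simp add: eq g ev_mult flip: mult.assoc sc_mult)
  qed
  moreover from this prim have "degree (smult (1 / D) r) = 0"
    unfolding primitive_def by blast
  then obtain c where c: "smult (1 / D) r = [:c:]"
    by (metis degree_eq_zeroE)
  moreover have "real_sq_poly [:c:] = sqC (sc c)"
    by (rule sq_poly_eqI) simp
  ultimately show ?thesis
    using that[of c] nz(2) by simp
qed

section \<open>Points, lines and reflections\<close>

text \<open>Specialises to the identity and to \<open>complexify\<close>, so that real points and
  complex tangents share their lemmas.\<close>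

definition lift :: "real sq \<Rightarrow> 'a::real_field sq"
  where "lift x = map_sq of_real x"

lemma lift_sel [simp]:
  "sq0 (lift x) = of_real (sq0 x)" "sq1 (lift x) = of_real (sq1 x)"
  "sq2 (lift x) = of_real (sq2 x)" "sq3 (lift x) = of_real (sq3 x)"
  by (simp_all add: lift_def sq.map_sel)

lemma lift_real [simp]: "lift x = x" for x :: "real sq"
  by (simp add: sq.expand)

lemma lift_complex: "lift x = complexify x"
  by (simp add: lift_def complexify_def)

lemma sq_inner_lift: "sq_inner (lift x) (lift y) = of_real (sq_inner x y)"
  by (simp add: sq_inner_eq)

definition quad :: "real sq \<Rightarrow> real sq \<Rightarrow> real sq \<Rightarrow> 'a::real_field \<Rightarrow> 'a sq"
  where "quad c2 c1 c0 t = sc (t\<^sup>2) * lift c2 + sc t * lift c1 + lift c0"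

lemma sq_inner_quad_left:
    "sq_inner (quad c2 c1 c0 t) x =
      t\<^sup>2 * sq_inner (lift c2) x + t * sq_inner (lift c1) x + sq_inner (lift c0) x"
  and sq_inner_quad_right:
    "sq_inner x (quad c2 c1 c0 t) =
      t\<^sup>2 * sq_inner x (lift c2) + t * sq_inner x (lift c1) + sq_inner x (lift c0)"
  for t :: "'a::real_field"
  by (simp_all add: quad_def sq_inner_linear)

lemma sqV_iff: "x \<in> sqV \<longleftrightarrow> sq0 x = 0"
  by (simp add: sqV_def)

lemma self_in_pt: "x \<in> pt x"
  unfolding pt_def by (rule range_eqI[of _ _ 1]) simp

lemma pt_scale:
  fixes c :: "'a::field"
  assumes "c \<noteq> 0"
  shows "pt (sc c * x) = pt x"
proof -
  have "sc a * x \<in> range (\<lambda>b. sc b * (sc c * x))" for a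
    using assms by (intro range_eqI[of _ _ "a / c"]) (simp flip: mult.assoc sc_mult)
  then show ?thesis
    by (auto simp: pt_def simp flip: mult.assoc sc_mult)
qed

lemma pt_in_points [simp]: "sq0 x = 0 \<Longrightarrow> x \<noteq> 0 \<Longrightarrow> pt x \<in> points"
  by (auto simp: points_def sqV_iff)

lemma points_set_eqI:
  assumes "A \<subseteq> points" "B \<subseteq> points" "\<And>x. pt x \<in> A \<longleftrightarrow> pt x \<in> B"
  shows "A = B"
  using assms by (auto simp: points_def)

lemma line_subset_points: "line u \<subseteq> points" and tangent_subset_points: "tangent A X \<subseteq> points"
  by (auto simp: line_def tangent_def)

lemma pt_in_line_iff:
  "pt x \<in> line w \<longleftrightarrow> pt x \<in> points \<and> sq_inner w x = 0" for x :: "'a::real_field sq"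
  using self_in_pt[of x] by (auto simp: line_def pt_def sq_inner_linear)

text \<open>The equations \<open>cross\<close> say that the cross product u x w vanishes, while u x
  (u x w) is, up to sign, \<open>sc (sq_inner u u) * w - sc (sq_inner u w) * u\<close>.\<close>

lemma nonnull_parallel:
  fixes u w :: "real sq"
  assumes "sq0 u = 0" "sq0 w = 0" "sq_inner u u \<noteq> 0"
    and cross: "sq2 u * sq3 w = sq3 u * sq2 w" "sq3 u * sq1 w = sq1 u * sq3 w"
      "sq1 u * sq2 w = sq2 u * sq1 w"
  shows "w = sc (sq_inner u w / sq_inner u u) * u"
proof -
  have "sc (sq_inner u u) * w = sc (sq_inner u w) * u"
    using assms(1,2) cross by (intro sq.expand) (simp add: sq_inner_eq, algebra)
  then have "sc (1 / sq_inner u u) * (sc (sq_inner u u) * w) =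
      sc (1 / sq_inner u u) * (sc (sq_inner u w) * u)"
    by simp
  then show ?thesis
    using assms(3) by (simp flip: mult.assoc sc_mult)
qed

lemma line_eq_imp_parallel:
  fixes u w :: "real sq"
  assumes "sq0 u = 0" "sq0 w = 0" "sq_inner u u \<noteq> 0" "line u = line w"
  shows "w = sc (sq_inner u w / sq_inner u u) * u"
proof -
  have orth: "sq_inner w x = 0" if "sq0 x = 0" "sq_inner u x = 0" for x
  proof (cases "x = 0")
    case False
    then have "pt x \<in> line u"
      using that by (simp add: pt_in_line_iff)
    then show ?thesis
      using assms(4) by (simp add: pt_in_line_iff)
  qed simp
  \<comment> \<open>The three test vectors are, up to sign, the cross products of \<open>u\<close>
    with the basis vectors, hence orthogonal to \<open>u\<close>.\<close>
  have "sq2 u * sq3 w = sq3 u * sq2 w"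
    using orth[of "Sq 0 0 (sq3 u) (- sq2 u)"] by (simp add: sq_inner_eq algebra_simps)
  moreover have "sq3 u * sq1 w = sq1 u * sq3 w"
    using orth[of "Sq 0 (sq3 u) 0 (sq1 u)"] by (simp add: sq_inner_eq algebra_simps)
  moreover have "sq1 u * sq2 w = sq2 u * sq1 w"
    using orth[of "Sq 0 (sq2 u) (sq1 u) 0"] by (simp add: sq_inner_eq algebra_simps)
  ultimately show ?thesis
    using assms(1-3) by (intro nonnull_parallel)
qed

lemma reflection_scale:
  assumes "c \<noteq> 0"
  shows "reflection (sc c * u) = reflection u"
proof -
  have "sc (2 * (sq_inner (sc c * u) x / sq_inner (sc c * u) (sc c * u))) * (sc c * u) =
      sc (2 * (sq_inner u x / sq_inner u u)) * u" for x
    using assms by (simp add: sq_inner_linear flip: mult.assoc sc_mult)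
  then show ?thesis
    by (simp add: reflection_def fun_eq_iff)
qed

lemma reflection_pt:
  "reflection u (pt x) = pt (x - sc (2 * (sq_inner u x / sq_inner u u)) * u)"
proof -
  have "sc c * x - sc (2 * (sq_inner u (sc c * x) / sq_inner u u)) * u =
      sc c * (x - sc (2 * (sq_inner u x / sq_inner u u)) * u)" for c
    by (intro sq.expand) (simp add: sq_inner_linear algebra_simps)
  then show ?thesis
    by (simp add: reflection_def pt_def image_image)
qed

section \<open>A conic with its tangents\<close>

text \<open>The signs absorb the signature of \<open>sq_inner\<close>: for pure \<open>w\<close> the
  dot product with \<open>coords x\<close> is \<open>sq_inner w x\<close>.\<close>

definition dual_coords :: "real sq \<Rightarrow> real ^ 3"
  where "dual_coords w = vector [sq1 w, - sq2 w, - sq3 w]"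

text \<open>
  The lines \<open>quad w2 w1 w0 t\<close> envelop a conic with the points \<open>quad T2 T1 T0 t\<close>: the assumptions
  say that line \<open>t\<close> and point \<open>s\<close> have the inner product \<open>D * (t - s)\<^sup>2\<close>.
\<close>

locale conic_envelope =
  fixes w2 w1 w0 T2 T1 T0 :: "real sq" and D :: real
  assumes w_pure: "sq0 w2 = 0" "sq0 w1 = 0" "sq0 w0 = 0"
    and T_pure: "sq0 T2 = 0" "sq0 T1 = 0" "sq0 T0 = 0"
    and D_nonzero: "D \<noteq> 0"
    and pairing:
      "sq_inner w2 T2 = 0" "sq_inner w2 T1 = 0" "sq_inner w2 T0 = D"
      "sq_inner w1 T2 = 0" "sq_inner w1 T1 = - 2 * D" "sq_inner w1 T0 = 0"
      "sq_inner w0 T2 = D" "sq_inner w0 T1 = 0" "sq_inner w0 T0 = 0"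
begin

text \<open>Minus the discriminant of the quadratic polynomial \<open>sq_inner (quad w2 w1 w0 t) x\<close> in \<open>t\<close>.\<close>

definition form :: "real ^ 3 ^ 3" where
  "form = (\<chi> i j. 2 * dual_coords w0 $ i * dual_coords w2 $ j
    + 2 * dual_coords w2 $ i * dual_coords w0 $ j - dual_coords w1 $ i * dual_coords w1 $ j)"

lemma bil_form:
  "bil form x y = 2 * sq_inner (lift w0) x * sq_inner (lift w2) y
    + 2 * sq_inner (lift w2) x * sq_inner (lift w0) y
    - sq_inner (lift w1) x * sq_inner (lift w1) y"
  unfolding bil_def form_def
  by (simp add: sum_3 vector_3 dual_coords_def coords_def sq_inner_eq w_pure) (simp add: algebra_simps)

lemma pairing_quad:
  "sq_inner (lift w2) (quad T2 T1 T0 t) = of_real D"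
  "sq_inner (lift w1) (quad T2 T1 T0 t) = - 2 * of_real D * t"
  "sq_inner (lift w0) (quad T2 T1 T0 t) = of_real D * t\<^sup>2"
  "sq_inner (lift w2) (lift T2) = 0"
  "sq_inner (lift w1) (lift T2) = 0"
  "sq_inner (lift w0) (lift T2) = of_real D"
  by (simp_all add: sq_inner_quad_right sq_inner_lift pairing)

lemma pairing_quad_quad:
  "sq_inner (quad w2 w1 w0 t) (quad T2 T1 T0 s) = of_real D * (t - s)\<^sup>2"
  by (simp add: sq_inner_quad_left pairing_quad power2_eq_square algebra_simps)

text \<open>The polar of point \<open>t\<close> is line \<open>t\<close>: the pairings of the point
  with \<open>w2\<close>, \<open>w1\<close>, \<open>w0\<close> are D, -2Dt, Dt^2. The second
  equation is the case of the parameter at infinity.\<close>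

lemma bil_form_quad:
  "bil form (quad T2 T1 T0 t) y = 2 * of_real D * sq_inner (quad w2 w1 w0 t) y"
  "bil form (lift T2) y = 2 * of_real D * sq_inner (lift w2) y"
  by (simp_all add: bil_form pairing_quad sq_inner_quad_left power2_eq_square algebra_simps)

lemma quad_w_pure [simp]: "sq0 (quad w2 w1 w0 t) = 0"
  and quad_T_pure [simp]: "sq0 (quad T2 T1 T0 t) = 0"
  by (simp_all add: quad_def w_pure T_pure)

lemma quad_T_nonzero: "quad T2 T1 T0 t \<noteq> (0 :: 'a::real_field sq)"
  using pairing_quad(1)[of t] D_nonzero by auto

lemma quad_w_nonzero: "quad w2 w1 w0 t \<noteq> (0 :: 'a::real_field sq)"
  using pairing_quad_quad[of t "t + 1"] D_nonzero by auto

lemma w2_nonzero: "w2 \<noteq> 0" and T2_nonzero: "T2 \<noteq> 0"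
  using pairing D_nonzero by auto

text \<open>The matrix of pairings of the \<open>w\<close> with the \<open>T\<close> is antidiagonal
  and factors through \<open>?W\<close>, so the three functionals are linearly independent.\<close>

lemma det_lines: "det (vector [dual_coords w0, dual_coords w1, dual_coords w2] :: real^3^3) \<noteq> 0"
proof -
  let ?W = "vector [dual_coords w0, dual_coords w1, dual_coords w2] :: real^3^3"
  let ?T = "vector [coords T0, coords T1, coords T2] :: real^3^3"
  have inner: "dual_coords w $ 1 * coords x $ 1 + dual_coords w $ 2 * coords x $ 2
      + dual_coords w $ 3 * coords x $ 3 = sq_inner w x" if "sq0 w = 0" for w x
    using that by (simp add: dual_coords_def coords_def vector_3 sq_inner_eq)
  have "det ?W * det ?T = det (?W ** transpose ?T)"
    by (simp add: det_mul)
  also have "\<dots> = 2 * D ^ 3"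
    unfolding det_3 matrix_matrix_mult_def
    by (simp add: sum_3 vector_3 transpose_def inner w_pure pairing power3_eq_cube)
  finally show ?thesis
    using D_nonzero by auto
qed

lemma eq_0_if_orthogonal:
  fixes x :: "real sq"
  assumes "sq0 x = 0" "sq_inner w0 x = 0" "sq_inner w1 x = 0" "sq_inner w2 x = 0"
  shows "x = 0"
proof -
  let ?W = "vector [dual_coords w0, dual_coords w1, dual_coords w2] :: real^3^3"
  have "?W *v coords x = 0"
    using assms
    by (simp add: vec_eq_iff forall_3 matrix_vector_mult_def sum_3 vector_3 dual_coords_def
        coords_def sq_inner_eq)
  moreover have "invertible ?W"
    using det_lines by (simp add: invertible_det_nz)
  ultimately have "coords x = 0"
    by (metis invertible_def matrix_left_invertible_ker)
  then show ?thesis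
    using assms(1) by (intro sq.expand) (simp add: coords_def vec_eq_iff forall_3 vector_3)
qed

lemma regular_form: "regular_form form"
proof -
  let ?W = "vector [dual_coords w0, dual_coords w1, dual_coords w2] :: real^3^3"
  \<comment> \<open>The matrix of 4 y0 y2 - y1^2, in the values y0, y1, y2 of the three
    functionals.\<close>
  let ?K = "vector [vector [0, 0, 2], vector [0, - 1, 0], vector [2, 0, 0]] :: real^3^3"
  have "form = transpose ?W ** ?K ** ?W"
    by (simp add: form_def vec_eq_iff forall_3 matrix_matrix_mult_def sum_3 vector_3 transpose_def)
  then have "det form = det ?W * det ?K * det ?W"
    by (simp add: det_mul)
  also have "det ?K = 4"
    by (simp add: det_3 vector_3)
  finally have "det form \<noteq> 0"
    using det_lines by simp
  moreover have "transpose form = form"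
    by (simp add: form_def transpose_def vec_eq_iff algebra_simps)
  ultimately show ?thesis
    by (simp add: regular_form_def)
qed

lemma bil_form_scale: "bil form (sc a * x) (sc b * y) = a * b * bil form x y"
  by (simp add: bil_form sq_inner_linear algebra_simps)

lemma pt_in_conic_iff:
  "pt x \<in> conic_of form \<longleftrightarrow> pt x \<in> points \<and> bil form x x = 0"
  using self_in_pt[of x] by (auto simp: conic_of_def pt_def bil_form_scale)

lemma pt_in_tangent_iff:
  "pt y \<in> tangent form (pt x) \<longleftrightarrow> pt y \<in> points \<and> bil form x y = 0"
  using self_in_pt[of x] self_in_pt[of y] by (auto simp: tangent_def pt_def bil_form_scale)

lemma tangent_quad:
  "tangent form (pt (quad T2 T1 T0 t)) = line (quad w2 w1 w0 t :: 'a::real_field sq)"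
  by (intro points_set_eqI line_subset_points tangent_subset_points)
    (simp add: pt_in_tangent_iff pt_in_line_iff bil_form_quad D_nonzero)

lemma tangent_T2: "tangent form (pt T2) = line w2"
  using bil_form_quad(2)[where 'a = real]
  by (intro points_set_eqI line_subset_points tangent_subset_points)
    (simp add: pt_in_tangent_iff pt_in_line_iff D_nonzero)

lemma quad_in_conic: "pt (quad T2 T1 T0 t) \<in> conic_of form" for t :: "'a::real_field"
  using pairing_quad_quad[of t t]
  by (simp add: pt_in_conic_iff quad_T_nonzero bil_form_quad)

text \<open>A point lies on the conic iff the quadratic \<open>sq_inner (quad w2 w1 w0 t) x\<close>
  has a double root; this root is its parameter, infinity if the leading coefficient
  vanishes.\<close>

lemma conic_eq:
  "conic_of form = insert (pt T2) (range (\<lambda>t :: real. pt (quad T2 T1 T0 t)))"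
proof (intro equalityI subsetI)
  fix X :: "real sq set" assume "X \<in> conic_of form"
  moreover then obtain x where X: "X = pt x" and x: "sq0 x = 0" "x \<noteq> 0"
    unfolding conic_of_def points_def sqV_def by blast
  ultimately have disc: "(sq_inner w1 x)\<^sup>2 = 4 * sq_inner w0 x * sq_inner w2 x"
    by (simp add: pt_in_conic_iff bil_form power2_eq_square)
  show "X \<in> insert (pt T2) (range (\<lambda>t :: real. pt (quad T2 T1 T0 t)))"
  proof (cases "sq_inner w2 x = 0")
    case True
    with disc have "sq_inner w1 x = 0"
      by simp
    \<comment> \<open>The scalar is read off from the pairing with \<open>w0\<close>, the only one
      of the three that is nonzero on \<open>T2\<close>.\<close>
    then have "x - sc (sq_inner w0 x / D) * T2 = 0"
      using True D_nonzero x T_pure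
      by (intro eq_0_if_orthogonal) (simp_all add: sq_inner_linear pairing)
    then have eq: "x = sc (sq_inner w0 x / D) * T2"
      by simp
    with x(2) have "sq_inner w0 x / D \<noteq> 0"
      by (metis mult_zero_left sc_0)
    with eq X have "X = pt T2"
      by (metis pt_scale)
    then show ?thesis by simp
  next
    case False
    \<comment> \<open>The double root.\<close>
    define t where "t = - sq_inner w1 x / (2 * sq_inner w2 x)"
    have "sq_inner w1 x = - 2 * t * sq_inner w2 x"
      using False by (simp add: t_def)
    moreover from this disc have "sq_inner w0 x = t\<^sup>2 * sq_inner w2 x"
      using False by (simp add: power2_eq_square)
    ultimately have "x - sc (sq_inner w2 x / D) * quad T2 T1 T0 t = 0"
      using D_nonzero x pairing_quad(1-3)[of t]
      by (intro eq_0_if_orthogonal) (simp_all add: sq_inner_linear)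
    then have eq: "x = sc (sq_inner w2 x / D) * quad T2 T1 T0 t"
      by simp
    have "sq_inner w2 x / D \<noteq> 0"
      using False D_nonzero by simp
    with eq X have "X = pt (quad T2 T1 T0 t)"
      by (metis pt_scale)
    then show ?thesis by simp
  qed
next
  fix X assume "X \<in> insert (pt T2) (range (\<lambda>t :: real. pt (quad T2 T1 T0 t)))"
  moreover have "pt T2 \<in> conic_of form"
    using bil_form_quad(2)[of T2]
    by (simp add: pt_in_conic_iff T2_nonzero T_pure pairing)
  ultimately show "X \<in> conic_of form"
    using quad_in_conic by auto
qed

text \<open>Tangents through \<open>x\<close> correspond to roots \<open>z\<close> of its quadratic;
  two distinct roots at which the line vector is null give two distinct null tangents.\<close>

lemma focal_pointI:
  fixes z1 z2 :: complex
  assumes "z1 \<noteq> z2" and x: "sq0 x = 0" "x \<noteq> 0"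
    and null: "\<And>z. z \<in> {z1, z2} \<Longrightarrow> sq_inner (quad w2 w1 w0 z) (quad w2 w1 w0 z) = 0"
    and on: "\<And>z. z \<in> {z1, z2} \<Longrightarrow> sq_inner (quad w2 w1 w0 z) (complexify x) = 0"
  shows "pt x \<in> focal_points form"
proof -
  have tangents: "line (quad w2 w1 w0 z) \<in> null_tangents form" if "z \<in> {z1, z2}" for z
    unfolding null_tangents_def
    using quad_in_conic[of z] tangent_quad[of z] null[OF that] quad_w_nonzero[of z]
    by (auto simp: sqV_iff intro!: bexI[of _ "pt (quad T2 T1 T0 z)"] bexI[of _ "quad w2 w1 w0 z"])
  have "complexify x \<noteq> 0"
    using x by (cases x) (auto simp: complexify_def zero_sq_def)
  then have x_pt: "pt (complexify x) \<in> points"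
    using x by (simp flip: lift_complex)
  \<comment> \<open>The lines are told apart by the contact point of the first, whose pairing with
    the second is D (z2 - z1)^2.\<close>
  have "pt (quad T2 T1 T0 z1) \<in> line (quad w2 w1 w0 z1)"
    by (simp add: pt_in_line_iff quad_T_nonzero pairing_quad_quad)
  moreover have "pt (quad T2 T1 T0 z1) \<notin> line (quad w2 w1 w0 z2)"
    using assms(1) D_nonzero by (simp add: pt_in_line_iff pairing_quad_quad)
  ultimately have "line (quad w2 w1 w0 z1) \<noteq> line (quad w2 w1 w0 z2)"
    by metis
  moreover have "pt (complexify x) \<in> line (quad w2 w1 w0 z1) \<inter> line (quad w2 w1 w0 z2)"
    using on x_pt by (simp add: pt_in_line_iff)
  ultimately have "\<exists>L\<in>null_tangents form. \<exists>L'\<in>null_tangents form.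
      L \<noteq> L' \<and> pt (complexify x) \<in> L \<inter> L'"
    using tangents[of z1] tangents[of z2] by blast
  moreover have "x \<in> sqV - {0}"
    using x by (simp add: sqV_iff)
  ultimately show ?thesis
    unfolding focal_points_def by blast
qed

end

section \<open>Moving joints, tangents and points of the conic\<close>

lemma fixed_axis_pure [simp]: "sq0 (fixed_axis h) = 0"
  by (simp add: fixed_axis_def)

lemma ev_moving_axis: "ev t (moving_axis h g) = (sc t - h) * fixed_axis g * (sc t - sq_cnj h)"
  by (simp only: ev_def moving_axis_at_Fin fixed_axis_def)

text \<open>The real polynomial (t - h)(t - \<open>sq_cnj h\<close>).\<close>

definition norm_poly :: "real sq \<Rightarrow> real poly"
  where "norm_poly h = [:sq_inner h h, - 2 * sq0 h, 1:]"

lemma poly_norm_poly: "poly (norm_poly h) t = sq_inner (sc t - h) (sc t - h)"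
  by (simp add: norm_poly_def sq_inner_eq power2_eq_square algebra_simps)

lemma quadratic_zero:
  fixes a b c :: real
  assumes "\<And>t. t\<^sup>2 * a + t * b + c = 0"
  shows "a = 0" "b = 0" "c = 0"
  using assms[of 0] assms[of 1] assms[of "-1"] by auto

lemma quartic_zero:
  fixes a b c d f :: real
  assumes "\<And>t. a * t ^ 4 + b * t ^ 3 + c * t\<^sup>2 + d * t + f = 0"
  shows "a = 0" "b = 0" "c = 0" "d = 0" "f = 0"
  using assms[of 0] assms[of 1] assms[of "-1"] assms[of 2] assms[of "-2"] by auto

text \<open>With A = t - h, the adjoint of y -> A y cnj(A) is y -> cnj(A) y A. It scales the axis of
  \<open>h\<close> by the norm of A, because A commutes with that axis.\<close>

lemma sq_inner_mult_axis:
  "sq_inner ((sc t - h) * y * (sc t - sq_cnj h)) (fixed_axis h) =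
    sq_inner (sc t - h) (sc t - h) * sq_inner y (fixed_axis h)"
  for y :: "real sq"
  by (simp add: sq_inner_eq sq_defs fixed_axis_def algebra_simps)

lemma linear_factors:
  "(sc t - a) * (sc t - b) = sc (t\<^sup>2) - sc t * (a + b) + a * b" for a b :: "real sq"
  by (intro sq.expand) (simp add: sq_defs power2_eq_square algebra_simps)

locale double_factorization =
  fixes h1 h2 k1 k2 e c1 c0 :: "real sq"
  assumes e: "e = k2 - h1" "e = h2 - k1"
    and c1: "c1 = h1 + h2" "c1 = k1 + k2"
    and c0: "c0 = h1 * h2" "c0 = k1 * k2"
    and norm_eq: "norm_poly k2 = norm_poly h1" "norm_poly h2 = norm_poly k1"
begin

text \<open>Each result about \<open>h1\<close> yields its twin about \<open>k1\<close>. The vectors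
  \<open>w2\<close>, \<open>w1\<close>, \<open>w0\<close> stay the same, as they depend only on
  \<open>e\<close>, \<open>c1\<close>, \<open>c0\<close>.\<close>

lemma swap: "double_factorization k1 k2 h1 h2 e c1 c0"
  using e c1 c0 norm_eq by unfold_locales simp_all

text \<open>The coefficients of the vector polynomial \<open>e * sq_cnj C + C * e\<close>.\<close>

definition w2 where "w2 = e + e"
definition w1 where "w1 = - (e * sq_cnj c1 + c1 * e)"
definition w0 where "w0 = e * sq_cnj c0 + c0 * e"

lemma e_pure: "sq0 e = 0"
  using norm_eq(1) e(1) by (simp add: norm_poly_def)

lemma w_pure: "sq0 w2 = 0" "sq0 w1 = 0" "sq0 w0 = 0"
  using e_pure by (simp_all add: w2_def w1_def w0_def times_sq_def)

lemma sq_inner_h2: "sq_inner h2 h2 = sq_inner k1 k1" and sq0_h2: "sq0 h2 = sq0 k1"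
  using norm_eq by (simp_all add: norm_poly_def)

text \<open>The moving axis and the multiple of \<open>fixed_axis k1\<close> both have the form X
  cnj(C) - C cnj(X), which is additive in X; their X are t - h1 and t - k2, with difference
  \<open>e\<close>.\<close>

lemma moving_axis_eq:
  "ev t (moving_axis h1 h2) = quad w2 w1 w0 t + sc (poly (norm_poly h1) t) * fixed_axis k1"
proof -
  define A B A' B' C where defs: "A = sc t - h1" "B = sc t - h2" "A' = sc t - k1" "B' = sc t - k2"
    "C = sc (t\<^sup>2) - sc t * c1 + c0"
  have C: "C = A * B" "C = A' * B'"
    by (simp_all add: defs linear_factors flip: c1 c0)
  have M: "sc (poly (norm_poly h1) t) = A * sq_cnj A" "sc (poly (norm_poly h1) t) = B' * sq_cnj B'"
    by (simp_all add: poly_norm_poly mult_sq_cnj defs flip: norm_eq)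
      (simp add: norm_eq flip: poly_norm_poly)
  have "ev t (moving_axis h1 h2) = A * (sq_cnj B - B) * sq_cnj A"
    by (simp add: ev_moving_axis fixed_axis_def defs sq_cnj_diff)
  also have "\<dots> = A * sq_cnj C - C * sq_cnj A"
    by (simp add: C(1) sq_cnj_mult algebra_simps)
  finally have 1: "ev t (moving_axis h1 h2) = A * sq_cnj C - C * sq_cnj A" .
  have "sc (poly (norm_poly h1) t) * fixed_axis k1
      = sc (poly (norm_poly h1) t) * sq_cnj A' - A' * sc (poly (norm_poly h1) t)"
    by (simp add: fixed_axis_def defs sq_cnj_diff sc_commute flip: right_diff_distrib)
  also have "\<dots> = (B' * sq_cnj B') * sq_cnj A' - A' * (B' * sq_cnj B')"
    by (simp only: M(2))
  also have "\<dots> = B' * sq_cnj C - C * sq_cnj B'"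
    by (simp add: C(2) sq_cnj_mult mult.assoc)
  finally have 2: "sc (poly (norm_poly h1) t) * fixed_axis k1 = B' * sq_cnj C - C * sq_cnj B'" .
  have e_eq: "A - B' = e"
    by (simp add: defs e(1))
  have cnj_e: "sq_cnj e = - e"
    using e_pure by (simp add: sq_defs)
  have "A * sq_cnj C - C * sq_cnj A - (B' * sq_cnj C - C * sq_cnj B')
      = (A - B') * sq_cnj C - C * sq_cnj (A - B')"
    by (simp add: sq_cnj_diff left_diff_distrib right_diff_distrib)
  also have "\<dots> = e * sq_cnj C + C * e"
    by (simp add: e_eq cnj_e)
  also have "\<dots> = quad w2 w1 w0 t"
    by (intro sq.expand) (simp add: defs w2_def w1_def w0_def quad_def times_sq_def algebra_simps)
  finally show ?thesis
    unfolding 1 2 by (simp add: algebra_simps)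
qed

section \<open>Inner products of the line vectors with the fixed axes and with themselves\<close>

lemma w2_eq: "w2 = fixed_axis h2 - fixed_axis k1"
proof -
  have "sq1 e = sq1 h2 - sq1 k1" "sq2 e = sq2 h2 - sq2 k1" "sq3 e = sq3 h2 - sq3 k1"
    by (simp_all add: e(2))
  then show ?thesis
    unfolding w2_def by (intro sq.expand) (simp add: fixed_axis_def e_pure)
qed

abbreviation D0 where "D0 \<equiv> sq_inner w2 w2"

lemma norm_fixed_axis: "sq_inner (fixed_axis h2) (fixed_axis h2) = sq_inner (fixed_axis k1) (fixed_axis k1)"
  using sq_inner_h2 sq0_h2 by (simp add: sq_inner_eq fixed_axis_def)

text \<open>\<open>w2\<close> is a difference a - b of vectors of equal norm, and then <a - b, b> =
  - <a - b, a - b> / 2.\<close>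

lemma inner_w2_k1: "sq_inner w2 (fixed_axis k1) = - D0 / 2"
  using norm_fixed_axis sq_inner_commute[of "fixed_axis h2" "fixed_axis k1"]
  by (simp add: w2_eq sq_inner_linear)

lemmas inner_w2_h1 = double_factorization.inner_w2_k1[OF swap]

text \<open>The line vector is the moved axis of \<open>h2\<close> minus M times the axis of
  \<open>k1\<close>, where M is \<open>norm_poly h1\<close>. Pairing the moved axis with the axis of
  \<open>h1\<close> also produces the factor M, and \<open>w2\<close> remains.\<close>

lemma inner_line_h1:
  "sq_inner (quad w2 w1 w0 t) (fixed_axis h1) = - D0 / 2 * poly (norm_poly h1) t"
proof -
  have "quad w2 w1 w0 t = (sc t - h1) * fixed_axis h2 * (sc t - sq_cnj h1)
      - sc (poly (norm_poly h1) t) * fixed_axis k1"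
    by (simp add: moving_axis_eq flip: ev_moving_axis)
  then have "sq_inner (quad w2 w1 w0 t) (fixed_axis h1) =
      poly (norm_poly h1) t * sq_inner (fixed_axis h2) (fixed_axis h1)
      - poly (norm_poly h1) t * sq_inner (fixed_axis k1) (fixed_axis h1)"
    by (simp only: sq_inner_diff_left sq_inner_scale_left sq_inner_mult_axis poly_norm_poly)
  also have "\<dots> = poly (norm_poly h1) t * sq_inner w2 (fixed_axis h1)"
    by (simp add: w2_eq sq_inner_linear algebra_simps)
  finally show ?thesis
    by (simp add: inner_w2_h1)
qed

text \<open>Comparison of coefficients in \<open>t\<close>; the coefficients also serve complex
  parameters later.\<close>

lemma inner_w_h1:
  "sq_inner w1 (fixed_axis h1) = D0 * sq0 h1"
  "sq_inner w0 (fixed_axis h1) = - D0 / 2 * sq_inner h1 h1"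
proof -
  have "t\<^sup>2 * (sq_inner w2 (fixed_axis h1) + D0 / 2) + t * (sq_inner w1 (fixed_axis h1) - D0 * sq0 h1)
      + (sq_inner w0 (fixed_axis h1) + D0 / 2 * sq_inner h1 h1) = 0" for t
    using inner_line_h1[of t]
    by (simp add: sq_inner_quad_left norm_poly_def power2_eq_square algebra_simps
        add_divide_distrib diff_divide_distrib)
  from quadratic_zero[OF this] show
    "sq_inner w1 (fixed_axis h1) = D0 * sq0 h1"
    "sq_inner w0 (fixed_axis h1) = - D0 / 2 * sq_inner h1 h1"
    by simp_all
qed

lemmas inner_w_k1 = double_factorization.inner_w_h1[OF swap]

text \<open>The moving axis w + M kappa1 has norm M^2 <kappa1, kappa1>, since \<open>h2\<close> and
  \<open>k1\<close> have axes of equal norm. Expanding leaves <w, w> = - 2 M <w, kappa1>.\<close>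

lemma inner_line_self:
  "sq_inner (quad w2 w1 w0 t) (quad w2 w1 w0 t) =
    D0 * poly (norm_poly h1) t * poly (norm_poly k1) t"
proof -
  let ?w = "quad w2 w1 w0 t" and ?M = "poly (norm_poly h1) t"
  let ?m = "?w + sc ?M * fixed_axis k1"
  have "sq_inner ?m ?m = ?M\<^sup>2 * sq_inner (fixed_axis h2) (fixed_axis h2)"
  proof -
    have "?m = (sc t - h1) * fixed_axis h2 * sq_cnj (sc t - h1)"
      by (simp add: ev_moving_axis sq_cnj_diff flip: moving_axis_eq)
    then show ?thesis
      by (simp add: sq_inner_mult_self sq_inner_cnj_self poly_norm_poly power2_eq_square)
  qed
  then have "sq_inner ?w ?w + 2 * ?M * sq_inner ?w (fixed_axis k1) = 0"
    using sq_inner_commute[of ?w "fixed_axis k1"]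
    by (simp add: norm_fixed_axis sq_inner_linear power2_eq_square algebra_simps)
  then show ?thesis
    by (simp add: double_factorization.inner_line_h1[OF swap])
qed

text \<open>Comparison of coefficients again. The coefficient of t^2 fixes only a combination of two
  products, which \<open>inner_w2_w0\<close> separates.\<close>

lemma inner_w_w:
  "sq_inner w2 w1 = - D0 * (sq0 h1 + sq0 k1)"
  "2 * sq_inner w2 w0 + sq_inner w1 w1 =
    D0 * (sq_inner h1 h1 + sq_inner k1 k1 + 4 * sq0 h1 * sq0 k1)"
  "sq_inner w1 w0 = - D0 * (sq0 h1 * sq_inner k1 k1 + sq0 k1 * sq_inner h1 h1)"
  "sq_inner w0 w0 = D0 * sq_inner h1 h1 * sq_inner k1 k1"
proof -
  have "0 * t ^ 4 + 2 * (sq_inner w2 w1 + D0 * (sq0 h1 + sq0 k1)) * t ^ 3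
      + (2 * sq_inner w2 w0 + sq_inner w1 w1
        - D0 * (sq_inner h1 h1 + sq_inner k1 k1 + 4 * sq0 h1 * sq0 k1)) * t\<^sup>2
      + 2 * (sq_inner w1 w0 + D0 * (sq0 h1 * sq_inner k1 k1 + sq0 k1 * sq_inner h1 h1)) * t
      + (sq_inner w0 w0 - D0 * sq_inner h1 h1 * sq_inner k1 k1) = 0" for t
    using inner_line_self[of t]
    by (simp add: sq_inner_quad_left sq_inner_quad_right sq_inner_commute[of w1 w2]
        sq_inner_commute[of w0 w2] sq_inner_commute[of w0 w1] norm_poly_def power_numeral_reduce
        algebra_simps)
  note quartic_zero[OF this]
  then show
    "sq_inner w2 w1 = - D0 * (sq0 h1 + sq0 k1)"
    "2 * sq_inner w2 w0 + sq_inner w1 w1 =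
      D0 * (sq_inner h1 h1 + sq_inner k1 k1 + 4 * sq0 h1 * sq0 k1)"
    "sq_inner w1 w0 = - D0 * (sq0 h1 * sq_inner k1 k1 + sq0 k1 * sq_inner h1 h1)"
    "sq_inner w0 w0 = D0 * sq_inner h1 h1 * sq_inner k1 k1"
    by simp_all
qed

section \<open>The point curve and its pairing with the lines\<close>

definition T2 where "T2 = w2 + fixed_axis h1 + fixed_axis k1"
definition T1 where
  "T1 = w1 - sc (2 * sq0 k1) * fixed_axis h1 - sc (2 * sq0 h1) * fixed_axis k1"
definition T0 where
  "T0 = w0 + sc (sq_inner k1 k1) * fixed_axis h1 + sc (sq_inner h1 h1) * fixed_axis k1"

lemma quad_T:
  "quad T2 T1 T0 t = quad w2 w1 w0 t + sc (poly (norm_poly k1) t) * fixed_axis h1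
    + sc (poly (norm_poly h1) t) * fixed_axis k1"
  by (intro sq.expand)
    (simp add: quad_def T2_def T1_def T0_def norm_poly_def power2_eq_square algebra_simps)

text \<open>The last factor is the norm of the leading coefficient of C - M, where M is the norm
  polynomial of \<open>h1\<close>; genericity controls it.\<close>

definition D where "D = - D0 / 2 * sq_inner (h1 - sq_cnj h2) (h1 - sq_cnj h2)"

text \<open>Both <e, e cnj(c0)> and <e, c0 e> equal <e, e> \<open>sq0 c0\<close>, and
  \<open>D0\<close> is 4 <e, e>.\<close>

lemma inner_w2_w0: "sq_inner w2 w0 = D0 * sq0 c0"
  by (simp add: w2_def w0_def sq_inner_eq times_sq_def algebra_simps)

text \<open>This form is visibly symmetric under \<open>swap\<close>, unlike the definition.\<close>

lemma D_eq: "D = D0 * (sq0 c0 - (sq_inner h1 h1 + sq_inner k1 k1) / 2)"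
proof -
  have norm: "sq_inner (h1 - sq_cnj h2) (h1 - sq_cnj h2) = sq_inner h1 h1 + sq_inner h2 h2 - 2 * sq0 c0"
    by (simp add: c0(1) sq_inner_eq times_sq_def algebra_simps)
  show ?thesis
    by (simp only: D_def norm sq_inner_h2) (simp add: field_simps)
qed

lemma conic_envelope:
  assumes "D \<noteq> 0"
  shows "conic_envelope w2 w1 w0 T2 T1 T0 D"
proof
  show "sq0 w2 = 0" "sq0 w1 = 0" "sq0 w0 = 0"
    by (rule w_pure)+
  then show "sq0 T2 = 0" "sq0 T1 = 0" "sq0 T0 = 0"
    by (simp_all add: T2_def T1_def T0_def)
  note inner = T2_def T1_def T0_def sq_inner_linear inner_w2_h1 inner_w2_k1 inner_w_h1 inner_w_k1
    sq_inner_commute[of w1 w2] sq_inner_commute[of w0 w2] sq_inner_commute[of w0 w1]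
  have w11: "sq_inner w1 w1 = D0 * (sq_inner h1 h1 + sq_inner k1 k1 + 4 * sq0 h1 * sq0 k1) - 2 * D0 * sq0 c0"
    using inner_w_w(2) by (simp add: inner_w2_w0)
  show "sq_inner w2 T2 = 0" "sq_inner w2 T1 = 0" "sq_inner w2 T0 = D"
    "sq_inner w1 T2 = 0" "sq_inner w1 T1 = - 2 * D" "sq_inner w1 T0 = 0"
    "sq_inner w0 T2 = D" "sq_inner w0 T1 = 0" "sq_inner w0 T0 = 0"
    by (simp_all add: inner inner_w_w inner_w2_w0 w11 D_eq field_simps)
qed (use assms in simp)

section \<open>Reflections of the fixed joints\<close>

lemma reflection_Fin:
  assumes "sq_inner (quad w2 w1 w0 t) (quad w2 w1 w0 t) \<noteq> 0"
  shows "reflection (quad w2 w1 w0 t) (fixed_joint h1) = moving_joint k1 k2 (Fin t)"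
proof -
  let ?w = "quad w2 w1 w0 t" and ?M = "poly (norm_poly h1) t" and ?N = "poly (norm_poly k1) t"
  \<comment> \<open>A non-null line keeps away from the roots of both norm polynomials, so division
    by \<open>?N\<close> is legitimate.\<close>
  have nz: "D0 \<noteq> 0" "?M \<noteq> 0" "?N \<noteq> 0"
    using assms by (auto simp: inner_line_self)
  have "sq_inner ?w (fixed_axis h1) / sq_inner ?w ?w = - (1 / (2 * ?N))"
    using nz by (simp add: inner_line_self inner_line_h1 field_simps)
  then have "fixed_axis h1 - sc (2 * (sq_inner ?w (fixed_axis h1) / sq_inner ?w ?w)) * ?w
      = fixed_axis h1 + sc (1 / ?N) * ?w"
    by (simp add: sc_minus)
  also have "\<dots> = sc (1 / ?N) * (?w + sc ?N * fixed_axis h1)"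
    using nz by (simp add: distrib_left flip: mult.assoc sc_mult)
  also have "?w + sc ?N * fixed_axis h1 = ev t (moving_axis k1 k2)"
    by (rule double_factorization.moving_axis_eq[OF swap, symmetric])
  finally show ?thesis
    using nz by (simp only: fixed_joint_def reflection_pt moving_joint_def ev_def) (simp add: pt_scale)
qed

lemma reflection_Infinity:
  assumes "D0 \<noteq> 0" "k2 \<noteq> sq_cnj k2"
  shows "reflection w2 (fixed_joint h1) = moving_joint k1 k2 Infinity"
proof -
  have "fixed_axis h1 - sc (2 * (sq_inner w2 (fixed_axis h1) / D0)) * w2 = fixed_axis h1 + w2"
    using assms(1) by (simp add: inner_w2_h1 sc_minus)
  also have "\<dots> = k2 - sq_cnj k2"
    using double_factorization.w2_eq[OF swap] by (simp add: fixed_axis_def)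
  finally show ?thesis
    by (simp only: fixed_joint_def reflection_pt moving_joint_def moving_axis_at_Infinity[OF assms(2)])
qed

section \<open>Complex null tangents through the fixed joints\<close>

lemma complex_inner_line_h1:
  "sq_inner (quad w2 w1 w0 z) (complexify (fixed_axis h1)) =
    - of_real D0 / 2 * (z\<^sup>2 - 2 * of_real (sq0 h1) * z + of_real (sq_inner h1 h1))"
  by (simp add: sq_inner_quad_left inner_w_h1 inner_w2_h1 sq_inner_lift algebra_simps flip: lift_complex)

lemma complex_inner_line_self:
  "sq_inner (quad w2 w1 w0 z) (quad w2 w1 w0 z) =
    of_real D0 * (z\<^sup>2 - 2 * of_real (sq0 h1) * z + of_real (sq_inner h1 h1)) *
      (z\<^sup>2 - 2 * of_real (sq0 k1) * z + of_real (sq_inner k1 k1))" for z :: complex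
proof -
  have "sq_inner w1 w1 =
      D0 * (sq_inner h1 h1 + sq_inner k1 k1 + 4 * sq0 h1 * sq0 k1) - 2 * sq_inner w2 w0"
    using inner_w_w(2) by simp
  then show ?thesis
    by (simp add: sq_inner_quad_left sq_inner_quad_right sq_inner_lift sq_inner_commute[of w1 w2]
        sq_inner_commute[of w0 w2] sq_inner_commute[of w0 w1] inner_w_w(1,3,4))
      (simp add: power2_eq_square algebra_simps)
qed

text \<open>At a root of the norm polynomial of \<open>h1\<close> the line is null and passes
  through the joint. The norm of the axis is minus the discriminant, so a non-null axis gives two
  distinct roots.\<close>

lemma fixed_joint_focal:
  assumes "D \<noteq> 0" "sq_inner (fixed_axis h1) (fixed_axis h1) \<noteq> 0"
  shows "fixed_joint h1 \<in> focal_points (conic_envelope.form w2 w1 w0)"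
proof -
  interpret conic_envelope w2 w1 w0 T2 T1 T0 D
    by (rule conic_envelope[OF assms(1)])
  define r where "r = csqrt (of_real ((sq0 h1)\<^sup>2 - sq_inner h1 h1))"
  have r: "r\<^sup>2 = (of_real (sq0 h1))\<^sup>2 - of_real (sq_inner h1 h1)"
    by (simp add: r_def)
  have "sq_inner (fixed_axis h1) (fixed_axis h1) = 4 * (sq_inner h1 h1 - (sq0 h1)\<^sup>2)"
    by (simp add: fixed_axis_def sq_inner_eq power2_eq_square)
  with assms(2) have "r \<noteq> 0"
    by (simp add: r_def flip: of_real_power of_real_diff)
  have root: "z\<^sup>2 - 2 * of_real (sq0 h1) * z + of_real (sq_inner h1 h1) = 0"
    if "z \<in> {of_real (sq0 h1) + r, of_real (sq0 h1) - r}" for z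
  proof -
    have "(z - of_real (sq0 h1))\<^sup>2 = r\<^sup>2"
      using that by auto
    with r have "(z - of_real (sq0 h1))\<^sup>2 = (of_real (sq0 h1))\<^sup>2 - of_real (sq_inner h1 h1)"
      by simp
    then show ?thesis
      by (simp add: power2_diff algebra_simps)
  qed
  show ?thesis
    unfolding fixed_joint_def
  proof (rule focal_pointI)
    show "complex_of_real (sq0 h1) + r \<noteq> of_real (sq0 h1) - r"
      using \<open>r \<noteq> 0\<close> by (simp add: eq_neg_iff_add_eq_0 algebra_simps)
    show "fixed_axis h1 \<noteq> 0"
      using assms(2) by auto
  qed (simp_all only: complex_inner_line_self complex_inner_line_h1 root fixed_axis_pure mult_zero_left
      mult_zero_right)
qed

end

section \<open>The intersection point as a polynomial\<close>

lemma sq_poly_at_Infinity_quadratic: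
  fixes a b c :: "real sq"
  assumes "a \<noteq> 0"
  shows "sq_poly_at (Poly_Mapping.single 2 a + Poly_Mapping.single 1 b + Poly_Mapping.single 0 c)
    Infinity = a"
proof -
  define P :: sq_poly where
    "P = Poly_Mapping.single 2 a + Poly_Mapping.single 1 b + Poly_Mapping.single 0 c"
  have look: "Poly_Mapping.lookup P n = (if n = 2 then a else if n = 1 then b else if n = 0 then c else 0)"
    for n
    by (auto simp: P_def lookup_add lookup_single when_def)
  have "Max (Poly_Mapping.keys P) = 2"
    using assms by (intro Max_eqI) (auto simp: in_keys_iff look split: if_splits)
  then have "sq_poly_at P Infinity = a"
    by (simp add: look)
  then show ?thesis
    by (simp only: P_def)
qed

lemma ev_poly_cross: "ev t (poly_cross P Q) = sc (1/2) * (ev t P * ev t Q - ev t Q * ev t P)"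
  by (simp add: poly_cross_def ev_mult ev_diff)

definition cross :: "real sq \<Rightarrow> real sq \<Rightarrow> real sq"
  where "cross x y = sc (1/2) * (x * y - y * x)"

lemma cross_eq:
  "cross x y = Sq 0 (sq3 x * sq2 y - sq2 x * sq3 y) (sq3 x * sq1 y - sq1 x * sq3 y)
    (sq1 x * sq2 y - sq2 x * sq1 y)"
  by (simp add: cross_def sq_defs algebra_simps)

text \<open>The vector on the right lies in both planes span(x, w + m y) and span(y, w + n x). The
  scalar is a triple product; where it vanishes, the intersection is undefined.\<close>

lemma cross_cross:
  assumes "sq0 x = 0" "sq0 y = 0" "sq0 w = 0"
  shows "cross (cross x (w + sc m * y)) (cross y (w + sc n * x)) =
    sc (sq_inner (cross x y) w) * (w + sc n * x + sc m * y)"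
  using assms by (intro sq.expand) (simp add: cross_eq sq_inner_eq algebra_simps)

context double_factorization
begin

lemma ev_meet_poly:
  "ev t (meet_poly h1 h2 k1 k2) =
    sc (sq_inner (cross (fixed_axis h1) (fixed_axis k1)) (quad w2 w1 w0 t)) * quad T2 T1 T0 t"
proof -
  have "sq0 (quad w2 w1 w0 t) = 0"
    by (simp add: quad_def w_pure)
  then show ?thesis
    by (simp add: meet_poly_def ev_poly_cross moving_axis_eq
        double_factorization.moving_axis_eq[OF swap] cross_cross quad_T flip: cross_def)
qed

text \<open>Parallel fixed axes would coincide, as both pair with \<open>w2\<close> to the same
  nonzero value. Their pairings with \<open>w1\<close> and \<open>w0\<close> would then make the
  norm polynomials equal.\<close>

lemma cross_fixed_axis_nonzero:
  assumes "D \<noteq> 0" "sq_inner (fixed_axis k1) (fixed_axis k1) \<noteq> 0" "norm_poly h1 \<noteq> norm_poly k1"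
  shows "cross (fixed_axis h1) (fixed_axis k1) \<noteq> 0"
proof
  assume zero: "cross (fixed_axis h1) (fixed_axis k1) = 0"
  obtain l where l: "fixed_axis h1 = sc l * fixed_axis k1"
  proof
    show "fixed_axis h1 = sc (sq_inner (fixed_axis k1) (fixed_axis h1) /
        sq_inner (fixed_axis k1) (fixed_axis k1)) * fixed_axis k1"
      using zero assms(2) by (intro nonnull_parallel) (simp_all add: cross_eq zero_sq_def mult.commute)
  qed
  have D0: "D0 \<noteq> 0"
    using assms(1) by (auto simp: D_def)
  have "l = 1"
    using inner_w2_h1 inner_w2_k1 D0 by (simp add: l sq_inner_linear)
  with l have "fixed_axis h1 = fixed_axis k1"
    by simp
  with inner_w_h1 inner_w_k1 D0 have "norm_poly h1 = norm_poly k1"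
    by (simp add: norm_poly_def)
  with assms(3) show False by simp
qed

lemma meet_point_eq:
  assumes D: "D \<noteq> 0" and "sq_inner (fixed_axis k1) (fixed_axis k1) \<noteq> 0"
    and "norm_poly h1 \<noteq> norm_poly k1"
  shows "meet_point h1 h2 k1 k2 (Fin t) = pt (quad T2 T1 T0 t)"
    and "meet_point h1 h2 k1 k2 Infinity = pt T2"
proof -
  interpret conic_envelope w2 w1 w0 T2 T1 T0 D
    by (rule conic_envelope[OF D])
  define g where "g = cross (fixed_axis h1) (fixed_axis k1)"
  define p where "p = [:sq_inner g w0, sq_inner g w1, sq_inner g w2:]"
  define T :: sq_poly where "T = Poly_Mapping.single 2 T2 + Poly_Mapping.single 1 T1 + Poly_Mapping.single 0 T0"
  have ev_T: "ev t T = quad T2 T1 T0 t" for t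
    by (simp add: T_def ev_add ev_single quad_def)
  have "sq0 g = 0"
    by (simp add: g_def cross_eq)
  moreover have "g \<noteq> 0"
    unfolding g_def by (rule cross_fixed_axis_nonzero[OF assms])
  \<comment> \<open>The coefficients of \<open>p\<close> pair the nonzero pure vector
    \<open>g\<close> with \<open>w0\<close>, \<open>w1\<close>, \<open>w2\<close>, which span the
    pure vectors.\<close>
  ultimately have "p \<noteq> 0"
    using eq_0_if_orthogonal[of g] by (auto simp: p_def sq_inner_commute[of g])
  have meet: "meet_poly h1 h2 k1 k2 = real_sq_poly p * T"
    by (intro sq_poly_eqI)
      (simp add: ev_meet_poly ev_mult ev_T p_def sq_inner_quad_right power2_eq_square algebra_simps
        flip: g_def)
  have "sq_inner w2 (ev t T) = D" for t
    using pairing_quad(1)[of t] by (simp add: ev_T)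
  then obtain c where c: "c \<noteq> 0" "reduced (meet_poly h1 h2 k1 k2) = sqC (sc c) * T"
    by (rule reduced_eqI[OF meet \<open>p \<noteq> 0\<close> D])
  show "meet_point h1 h2 k1 k2 (Fin t) = pt (quad T2 T1 T0 t)"
    by (simp only: meet_point_def c(2) ev_def[symmetric] ev_mult ev_sqC ev_T pt_scale[OF c(1)])
  have "sqC (sc c) * T = Poly_Mapping.single 2 (sc c * T2) + Poly_Mapping.single 1 (sc c * T1)
      + Poly_Mapping.single 0 (sc c * T0)"
    by (simp add: sqC_def T_def distrib_left mult_single numeral_2_eq_2)
  then show "meet_point h1 h2 k1 k2 Infinity = pt T2"
    using c(1) T2_nonzero
    by (simp only: meet_point_def c(2)) (simp only: sq_poly_at_Infinity_quadratic sc_mult_eq_0_iff pt_scale simp_thms)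
qed

end

section \<open>Consequences of genericity\<close>

text \<open>A null leading coefficient \<open>r1\<close> of C - M satisfies
  \<open>r1 * sq_cnj r1 = 0\<close>. Adding a nonzero right annihilator of \<open>r1\<close> to a
  zero of C - M gives another zero, against uniqueness.\<close>

lemma generic_leading_coeff:
  assumes "generic C" and C: "\<And>t. ev t C = sc (t\<^sup>2) + sc t * c1 + c0"
    and MN: "\<And>t. sq_inner (ev t C) (ev t C) = poly [:m0, m1, 1:] t * poly N t"
  shows "sq_inner (c1 - sc m1) (c1 - sc m1) \<noteq> 0"
proof
  assume null: "sq_inner (c1 - sc m1) (c1 - sc m1) = 0"
  have "C * poly_cnj C = real_sq_poly ([:m0, m1, 1:] * N)"
    by (rule sq_poly_eqI) (simp only: ev_mult ev_poly_cnj mult_sq_cnj MN ev_real_sq_poly poly_mult)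
  moreover have "degree [:m0, m1, 1:] = 2" "lead_coeff [:m0, m1, 1:] = 1"
    by simp_all
  ultimately obtain r1 r0 where r: "C - real_sq_poly [:m0, m1, 1:] = sqC r1 * sqT + sqC r0"
    and unique: "\<exists>!h. r1 * h + r0 = 0"
    using assms(1) unfolding generic_def by blast
  have *: "sc (t\<^sup>2) + sc t * c1 + c0 - sc (poly [:m0, m1, 1:] t) = r1 * sc t + r0" for t
    using arg_cong[OF r, of "ev t"] by (simp only: ev_diff ev_add ev_mult ev_sqC ev_sqT ev_real_sq_poly C)
  have r1: "r1 = c1 - sc m1"
    using *[of 1] *[of 0] by (simp add: sc_add algebra_simps)
  obtain h where h: "r1 * h + r0 = 0" "\<And>h'. r1 * h' + r0 = 0 \<Longrightarrow> h' = h"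
    using unique by blast
  have zero_divisor: "x = 0" if "r1 * x = 0" for x
    using h(2)[of "h + x"] h(1) that by (simp add: distrib_left)
  have "r1 * sq_cnj r1 = 0"
    by (simp only: r1 mult_sq_cnj null sc_0)
  then have "sq_cnj r1 = 0"
    by (rule zero_divisor)
  then have "sq_cnj (sq_cnj r1) = sq_cnj 0"
    by (rule arg_cong)
  then have "r1 = 0"
    by (simp only: sq_cnj_cnj sq_cnj_0)
  then have "r1 * 1 = 0"
    by simp
  then have "(1 :: real sq) = 0"
    by (rule zero_divisor)
  then show False by simp
qed

lemma generic_independent:
  assumes "generic C" and C: "\<And>t. ev t C = sc (t\<^sup>2) + sc t * c1 + c0"
    and zero: "sc a + sc b * c1 + sc c * c0 = 0"
  shows "a = 0" "b = 0" "c = 0"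
proof -
  obtain d1 d0 where d: "C = sqT ^ 2 + sqC d1 * sqT + sqC d0"
    and indep: "\<And>a b c. sc a + sc b * d1 + sc c * d0 = 0 \<Longrightarrow> a = 0 \<and> b = 0 \<and> c = 0"
    using assms(1) unfolding generic_def by blast
  have *: "sc (t\<^sup>2) + sc t * c1 + c0 = sc (t\<^sup>2) + d1 * sc t + d0" for t
    using C[of t] by (simp add: d ev_add ev_mult power2_eq_square sc_mult)
  have "c0 = d0" "c1 = d1"
    using *[of 0] *[of 1] by simp_all
  with indep zero show "a = 0" "b = 0" "c = 0"
    by blast+
qed

context double_factorization
begin

lemma ev_factors:
  assumes "\<And>t. ev t C = (sc t - h1) * (sc t - h2)"
  shows "ev t C = sc (t\<^sup>2) + sc t * (- c1) + c0"
    and "sq_inner (ev t C) (ev t C) = poly (norm_poly h1) t * poly (norm_poly k1) t"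
proof -
  show "ev t C = sc (t\<^sup>2) + sc t * (- c1) + c0"
    by (simp add: assms linear_factors c1(1) c0(1)) (simp add: algebra_simps)
  show "sq_inner (ev t C) (ev t C) = poly (norm_poly h1) t * poly (norm_poly k1) t"
    by (simp only: assms sq_inner_mult_self poly_norm_poly flip: norm_eq(2))
qed

lemma generic_norm_nonzero:
  assumes "generic C" "\<And>t. ev t C = (sc t - h1) * (sc t - h2)"
  shows "sq_inner (h1 - sq_cnj h2) (h1 - sq_cnj h2) \<noteq> 0"
proof -
  have "sq_inner (- c1 - sc (- 2 * sq0 h1)) (- c1 - sc (- 2 * sq0 h1)) \<noteq> 0"
    using assms(1) ev_factors(1)[OF assms(2)] ev_factors(2)[OF assms(2), unfolded norm_poly_def[of h1]]
    by (rule generic_leading_coeff)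
  then show ?thesis
    by (simp add: c1(1) sq_inner_eq algebra_simps)
qed

text \<open>For \<open>e = 0\<close> the elements \<open>h1\<close> and \<open>h2\<close> commute,
  so \<open>c1\<close> and \<open>c0\<close> lie in the span of 1 and the non-null axis of
  \<open>h1\<close>, contradicting linear independence.\<close>

lemma generic_e_nonzero:
  assumes "generic C" and C: "\<And>t. ev t C = (sc t - h1) * (sc t - h2)"
    and nonnull: "sq_inner (fixed_axis h1) (fixed_axis h1) \<noteq> 0"
  shows "e \<noteq> 0"
proof
  assume "e = 0"
  then have "h1 * h2 = h2 * h1"
    using e c0 by simp
  then have comm: "sq2 h1 * sq3 h2 = sq3 h1 * sq2 h2" "sq3 h1 * sq1 h2 = sq1 h1 * sq3 h2"
      "sq1 h1 * sq2 h2 = sq2 h1 * sq1 h2"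
    by (simp_all add: times_sq_def algebra_simps)
  obtain l where "fixed_axis h2 = sc l * fixed_axis h1"
  proof
    show "fixed_axis h2 = sc (sq_inner (fixed_axis h1) (fixed_axis h2) /
        sq_inner (fixed_axis h1) (fixed_axis h1)) * fixed_axis h1"
      using nonnull comm by (intro nonnull_parallel) (simp_all add: fixed_axis_def mult.commute)
  qed
  from arg_cong[OF this, of sq1] arg_cong[OF this, of sq2] arg_cong[OF this, of sq3]
  have l: "sq1 h2 = l * sq1 h1" "sq2 h2 = l * sq2 h1" "sq3 h2 = l * sq3 h1"
    by (simp_all add: fixed_axis_def)
  \<comment> \<open>The vector parts of \<open>c0\<close> and \<open>c1\<close> are
    \<open>?b\<close> and \<open>1 + l\<close> times that of \<open>h1\<close>, which dictates the
    relation below. If both factors vanish, \<open>c1\<close> itself is real.\<close>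
  let ?b = "sq0 h2 + l * sq0 h1"
  have "sc (?b * sq0 c1 - (1 + l) * sq0 c0) + sc ?b * - c1 + sc (1 + l) * c0 = 0"
    by (intro sq.expand) (simp add: c1(1) c0(1) l times_sq_def algebra_simps)
  from generic_independent[OF assms(1) ev_factors(1)[OF C] this]
  have "?b = 0" "l = - 1"
    by simp_all
  then have "sc (2 * sq0 h1) + sc 1 * - c1 + sc 0 * c0 = 0"
    using l by (intro sq.expand) (simp add: c1(1))
  from generic_independent(2)[OF assms(1) ev_factors(1)[OF C] this]
  show False by simp
qed

text \<open>
  If \<open>e\<close> were null, the form would be minus a square of a linear form on the plane orthogonal to
  \<open>e\<close>. The norm polynomials of \<open>h1\<close> and \<open>k1\<close> would then split, and regrouping their linear factors
  would give a quadratic factor that violates genericity.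
\<close>

lemma generic_e_nonnull:
  assumes "generic C" and C: "\<And>t. ev t C = (sc t - h1) * (sc t - h2)" and "e \<noteq> 0"
  shows "sq_inner e e \<noteq> 0"
proof
  assume null: "sq_inner e e = 0"
  have e1: "sq1 e \<noteq> 0"
  proof
    assume 0: "sq1 e = 0"
    with e_pure have "sq_inner e e = - ((sq2 e)\<^sup>2 + (sq3 e)\<^sup>2)"
      by (simp add: sq_inner_eq power2_eq_square)
    with null have "(sq2 e)\<^sup>2 + (sq3 e)\<^sup>2 = 0"
      by linarith
    then have "sq2 e = 0 \<and> sq3 e = 0"
      by (simp only: sum_power2_eq_zero_iff)
    then have "e = 0"
      using 0 e_pure by (intro sq.expand) simp
    with assms(3) show False by simp
  qed
  \<comment> \<open>The linear form whose square is minus the norm of the vector part on the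
    orthogonal complement of \<open>e\<close>; it vanishes at \<open>e\<close>.\<close>
  define phi where "phi x = (sq2 x * sq3 e - sq3 x * sq2 e) / sq1 e" for x
  have phi: "(sq0 x)\<^sup>2 - sq_inner x x = (phi x)\<^sup>2" if "sq_inner e x = 0" for x
  proof -
    have "sq1 e * sq1 x = sq2 e * sq2 x + sq3 e * sq3 x"
      using that e_pure by (simp add: sq_inner_eq)
    then have "(sq1 e * sq1 x)\<^sup>2 = (sq2 e * sq2 x + sq3 e * sq3 x)\<^sup>2"
      by simp
    moreover have e11: "(sq1 e)\<^sup>2 = (sq2 e)\<^sup>2 + (sq3 e)\<^sup>2"
      using null e_pure by (simp add: sq_inner_eq power2_eq_square)
    moreover have "(sq1 e)\<^sup>2 * ((sq0 x)\<^sup>2 - sq_inner x x) =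
        (sq1 e)\<^sup>2 * ((sq2 x)\<^sup>2 + (sq3 x)\<^sup>2) - (sq1 e * sq1 x)\<^sup>2"
      by (simp add: sq_inner_eq power2_eq_square algebra_simps)
    ultimately have "(sq1 e)\<^sup>2 * ((sq0 x)\<^sup>2 - sq_inner x x) = (sq2 x * sq3 e - sq3 x * sq2 e)\<^sup>2"
      by (simp add: power2_eq_square algebra_simps)
    then show ?thesis
      using e1 by (simp add: phi_def power_divide field_simps)
  qed
  have "D0 = 0"
    using null by (simp add: w2_def sq_inner_linear)
  then have orth: "sq_inner e h1 = 0" "sq_inner e k1 = 0"
    using inner_w2_h1 inner_w2_k1 e_pure
    by (simp_all add: w2_def fixed_axis_def sq_inner_eq)
  have split: "poly (norm_poly h) t = (t - (sq0 h + phi h)) * (t - (sq0 h - phi h))"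
    if "sq_inner e h = 0" for h t
    using phi[OF that] by (simp add: norm_poly_def power2_eq_square algebra_simps)
  \<comment> \<open>One root of each norm polynomial; \<open>?N\<close> takes the other two.\<close>
  let ?x = "sq0 h1 + phi h1" and ?y = "sq0 k1 + phi k1"
  let ?N = "[:- (sq0 h1 - phi h1), 1:] * [:- (sq0 k1 - phi k1), 1:]"
  have "sq_inner (ev t C) (ev t C) = poly [:?x * ?y, - (?x + ?y), 1:] t * poly ?N t" for t
    by (simp add: ev_factors(2)[OF C] split orth algebra_simps)
  with assms(1) ev_factors(1)[OF C]
  have nz: "sq_inner (- c1 - sc (- (?x + ?y))) (- c1 - sc (- (?x + ?y))) \<noteq> 0"
    by (rule generic_leading_coeff)
  have "sq_inner e c1 = 0"
  proof -
    have "c1 = h1 + k1 + e"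
      by (simp add: c1(1) e(2))
    then show ?thesis
      by (simp add: sq_inner_linear orth null)
  qed
  moreover have "phi c1 = phi h1 + phi k1" "sq0 c1 = sq0 h1 + sq0 k1"
  proof -
    have "sq2 c1 = sq2 h1 + sq2 k1 + sq2 e" "sq3 c1 = sq3 h1 + sq3 k1 + sq3 e"
      "sq0 c1 = sq0 h1 + sq0 k1 + sq0 e"
      by (simp_all add: c1(1) e(2))
    then show "phi c1 = phi h1 + phi k1" "sq0 c1 = sq0 h1 + sq0 k1"
      by (simp_all add: phi_def e_pure add_divide_distrib diff_divide_distrib algebra_simps)
  qed
  \<comment> \<open>So \<open>?x + ?y\<close> is a root of the norm polynomial of \<open>c1\<close>,
    which makes the leading coefficient null.\<close>
  ultimately have sum: "?x + ?y = sq0 c1 + phi c1" and "(sq0 c1)\<^sup>2 - sq_inner c1 c1 = (phi c1)\<^sup>2"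
    using phi[of c1] by simp_all
  moreover have "sq_inner (- c1 - sc (- s)) (- c1 - sc (- s)) =
      sq_inner c1 c1 - (sq0 c1)\<^sup>2 + (s - sq0 c1)\<^sup>2" for s
    by (simp add: sq_inner_eq power2_eq_square algebra_simps)
  ultimately have "sq_inner (- c1 - sc (- (?x + ?y))) (- c1 - sc (- (?x + ?y))) = 0"
    by (simp only: sum) simp
  with nz show False by simp
qed

end

section \<open>From the hypotheses to the conic\<close>

text \<open>Norms are multiplicative, so cancelling one factor in the norm of C matches
  \<open>h2\<close> with \<open>k1\<close> and \<open>k2\<close> with \<open>h1\<close>. Coprimality
  of two non-units keeps the norm polynomials distinct.\<close>

lemma complementary_imp_double_factorization:
  assumes "complementary C h1 h2 k1 k2"
  shows "double_factorization h1 h2 k1 k2 (k2 - h1) (h1 + h2) (h1 * h2)"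
    and "ev t C = (sc t - h1) * (sc t - h2)"
    and "norm_poly h1 \<noteq> norm_poly k1"
proof -
  obtain M N where C: "C = (sqT - sqC h1) * (sqT - sqC h2)" "C = (sqT - sqC k1) * (sqT - sqC k2)"
    and M: "real_sq_poly M = (sqT - sqC h1) * (sqT - sqC (sq_cnj h1))"
    and N: "real_sq_poly N = (sqT - sqC k1) * (sqT - sqC (sq_cnj k1))"
    and MN: "C * poly_cnj C = real_sq_poly M * real_sq_poly N" "coprime M N"
    using assms unfolding complementary_def by blast
  have ev_C: "ev t C = (sc t - h1) * (sc t - h2)" "ev t C = (sc t - k1) * (sc t - k2)" for t
    using arg_cong[OF C(1), of "ev t"] arg_cong[OF C(2), of "ev t"] by (simp_all add: ev_mult ev_diff)
  show "ev t C = (sc t - h1) * (sc t - h2)"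
    by (rule ev_C)
  have eq: "P = norm_poly h" if "real_sq_poly P = (sqT - sqC h) * (sqT - sqC (sq_cnj h))" for P h
  proof -
    have "sc (poly P t) = (sc t - h) * sq_cnj (sc t - h)" for t
      using arg_cong[OF that, of "ev t"] by (simp add: ev_mult ev_diff sq_cnj_diff)
    then have "poly P t = poly (norm_poly h) t" for t
      by (simp only: poly_norm_poly mult_sq_cnj sc_eq_iff)
    then show ?thesis
      by (simp add: poly_eq_poly_eq_iff[symmetric] fun_eq_iff)
  qed
  have "degree (norm_poly h) = 2" for h
    by (simp add: norm_poly_def)
  then have nz: "norm_poly h \<noteq> 0" "\<not> is_unit (norm_poly h)" for h
    by (auto simp: norm_poly_def is_unit_iff_degree)
  show "norm_poly h1 \<noteq> norm_poly k1"
    using MN(2) nz(2) by (auto simp: eq[OF M] eq[OF N])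
  have "sc (sq_inner (ev t C) (ev t C)) = sc (poly (norm_poly h1 * norm_poly k1) t)" for t
    using arg_cong[OF MN(1), of "ev t"] by (simp add: ev_mult mult_sq_cnj eq[OF M] eq[OF N] sc_mult)
  then have norm_C: "sq_inner (ev t C) (ev t C) = poly (norm_poly h1 * norm_poly k1) t" for t
    by (simp only: sc_eq_iff)
  have "poly (norm_poly h1 * norm_poly h2) t = poly (norm_poly h1 * norm_poly k1) t" for t
    using norm_C[of t] by (simp add: ev_C(1) sq_inner_mult_self poly_norm_poly)
  then have "norm_poly h1 * norm_poly h2 = norm_poly h1 * norm_poly k1"
    by (simp only: poly_eq_poly_eq_iff[symmetric] fun_eq_iff simp_thms)
  then have norm_h2: "norm_poly h2 = norm_poly k1"
    using nz by simp
  have "poly (norm_poly k1 * norm_poly k2) t = poly (norm_poly k1 * norm_poly h1) t" for t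
    using norm_C[of t] by (simp add: ev_C(2) sq_inner_mult_self poly_norm_poly)
  then have "norm_poly k1 * norm_poly k2 = norm_poly k1 * norm_poly h1"
    by (simp only: poly_eq_poly_eq_iff[symmetric] fun_eq_iff simp_thms)
  then have norm_k2: "norm_poly k2 = norm_poly h1"
    using nz by simp
  have *: "sc t * (k1 + k2) + h1 * h2 = sc t * (h1 + h2) + k1 * k2" for t
  proof -
    have "(sc t - h1) * (sc t - h2) = (sc t - k1) * (sc t - k2)"
      using ev_C[of t] by (rule trans[OF sym])
    then show ?thesis
      by (simp only: linear_factors) (simp add: algebra_simps)
  qed
  have prod: "h1 * h2 = k1 * k2" and sum: "h1 + h2 = k1 + k2"
    using *[of 0] *[of 1] by simp_all
  show "double_factorization h1 h2 k1 k2 (k2 - h1) (h1 + h2) (h1 * h2)"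
  proof
    show "k2 - h1 = h2 - k1"
      using sum by (simp add: algebra_simps)
  qed (simp_all add: prod sum norm_h2 norm_k2)
qed

theorem theorem2:
  fixes C :: sq_poly and h1 h2 k1 k2 :: "real sq"
  assumes "generic C"
    and "complementary C h1 h2 k1 k2"
    and "\<forall>h\<in>{h1, h2, k1, k2}. sq_inner (h - sq_cnj h) (h - sq_cnj h) \<noteq> 0"
  shows "\<exists>A. regular_form A \<and>
    range (meet_point h1 h2 k1 k2) = conic_of A \<and>
    fixed_joint h1 \<in> focal_points A \<and>
    fixed_joint k1 \<in> focal_points A \<and>
    (\<forall>t. \<forall>u\<in>sqV - {0}.
      line u = tangent A (meet_point h1 h2 k1 k2 t) \<and> sq_inner u u \<noteq> 0 \<longrightarrow>
      reflection u (fixed_joint h1) = moving_joint k1 k2 t \<and>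
      reflection u (fixed_joint k1) = moving_joint h1 h2 t)"
proof -
  define e where "e = k2 - h1"
  interpret double_factorization h1 h2 k1 k2 e "h1 + h2" "h1 * h2"
    unfolding e_def by (rule complementary_imp_double_factorization[OF assms(2)])
  note C = complementary_imp_double_factorization(2)[OF assms(2)]
  note distinct_norms = complementary_imp_double_factorization(3)[OF assms(2)]
  have nonnull: "sq_inner (fixed_axis h1) (fixed_axis h1) \<noteq> 0"
      "sq_inner (fixed_axis k1) (fixed_axis k1) \<noteq> 0"
    and moving: "h2 \<noteq> sq_cnj h2" "k2 \<noteq> sq_cnj k2"
    using assms(3) by (auto simp: fixed_axis_def)
  have "sq_inner e e \<noteq> 0"
    using generic_e_nonnull[OF assms(1) C] generic_e_nonzero[OF assms(1) C nonnull(1)] by blast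
  then have D0: "D0 \<noteq> 0"
    by (simp add: w2_def sq_inner_linear)
  have D: "D \<noteq> 0"
    using D0 generic_norm_nonzero[OF assms(1) C] by (simp add: D_def)
  interpret conic_envelope w2 w1 w0 T2 T1 T0 D
    by (rule conic_envelope[OF D])
  interpret sym: double_factorization k1 k2 h1 h2 e "h1 + h2" "h1 * h2"
    by (rule swap)
  \<comment> \<open>Only \<open>D\<close> needs a transfer here: the swapped interpretation has the
    same form of the conic, built from the same \<open>w2\<close>, \<open>w1\<close>,
    \<open>w0\<close>.\<close>
  have D_sym: "sym.D \<noteq> 0"
    using D unfolding D_eq sym.D_eq by (simp add: add.commute)
  note meet = meet_point_eq[OF D nonnull(2) distinct_norms]
  have range: "range (meet_point h1 h2 k1 k2) = conic_of form"
  proof -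
    have "range f = insert (f Infinity) (range (\<lambda>t. f (Fin t)))" for f :: "param \<Rightarrow> real sq set"
    proof -
      have UNIV_param: "(UNIV :: param set) = insert Infinity (range Fin)"
        using param.exhaust by auto
      show ?thesis
        by (simp only: UNIV_param image_insert image_image)
    qed
    then show ?thesis
      by (simp only: conic_eq meet)
  qed
  have focal: "fixed_joint h1 \<in> focal_points form"
    "fixed_joint k1 \<in> focal_points form"
    by (rule fixed_joint_focal[OF D nonnull(1)] sym.fixed_joint_focal[OF D_sym nonnull(2)])+
  have reflections: "reflection u (fixed_joint h1) = moving_joint k1 k2 t \<and>
      reflection u (fixed_joint k1) = moving_joint h1 h2 t"
    if u: "u \<in> sqV - {0}" "line u = tangent form (meet_point h1 h2 k1 k2 t)" "sq_inner u u \<noteq> 0" for t u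
  proof -
    \<comment> \<open>A non-null normal vector is determined by its line up to scale, so the
      reflection may be computed with the explicit tangent vector.\<close>
    have via: "sq_inner w w \<noteq> 0 \<and> reflection u = reflection w"
      if "line u = line w" "sq0 w = 0" "w \<noteq> 0" for w
    proof -
      define c where "c = sq_inner u w / sq_inner u u"
      have w: "w = sc c * u"
        unfolding c_def using u(1,3) that by (intro line_eq_imp_parallel) (simp_all add: sqV_iff)
      with that(3) have "c \<noteq> 0"
        by auto
      then show ?thesis
        using u(3) reflection_scale[of c u] by (simp add: w sq_inner_linear)
    qed
    show ?thesis
    proof (cases t)
      case (Fin s)
      have "line u = line (quad w2 w1 w0 s)"
        using u(2) by (simp add: Fin meet tangent_quad)
      from via[OF this quad_w_pure quad_w_nonzero] show ?thesis
        by (simp only: Fin reflection_Fin sym.reflection_Fin simp_thms)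
    next
      case Infinity
      have "line u = line w2"
        using u(2) by (simp add: Infinity meet tangent_T2)
      from via[OF this w_pure(1) w2_nonzero] have u_eq: "reflection u = reflection w2" ..
      show ?thesis
        by (simp only: Infinity u_eq reflection_Infinity[OF D0 moving(2)]
            sym.reflection_Infinity[OF D0 moving(1)])
    qed
  qed
  show ?thesis
  proof (intro exI[of _ form] conjI allI ballI impI)
    fix t u
    assume "u \<in> sqV - {0}" "line u = tangent form (meet_point h1 h2 k1 k2 t) \<and> sq_inner u u \<noteq> 0"
    then show "reflection u (fixed_joint h1) = moving_joint k1 k2 t"
      and "reflection u (fixed_joint k1) = moving_joint h1 h2 t"
      using reflections by simp_all
  qed (rule regular_form range focal)+
qed

end
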